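(* Let $B$ be a barrier of a matching covered graph $G$, and let $J$ be a matching covered graph with maximum degree $\Delta(J)\le 3$. If there exists a component $L$ of $G-B$ such that $G/\overline{V(L)}$ is $J$-based, then $G$ is $J$-based.
   Context: Graphs loopless; multiple edges allowed. A connected graph with at least two vertices is matching covered if every edge lies in a perfect matching. A barrier of a graph with a perfect matching is a set $B$ of vertices such that the number of odd components of $G-B$ equals $|B|$. For $X\subseteq V(G)$, $G/\overline{X}$ is obtained by shrinking $V(G)-X$ to a single vertex. A subgraph $H$ of $G$ is conformal if $G-V(H)$ has a perfect matching; a bisubdivision of $J$ is obtained by replacing some edges of $J$ by paths with an even number of internal vertices; a matching covered graph is $J$-based if it has a conformal subgraph that is a bisubdivision of $J$. *)

theory Defs
  imports Main
begin

text \<open>Finite undirected multigraphs. Edges have an identity of their own, so parallel edges are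
  distinct elements of the edge set with the same pair of ends; the values of \<open>ends\<close> outside the
  edge set are irrelevant.\<close>

record ('v, 'e) multigraph =
  verts :: "'v set"
  edges :: "'e set"
  ends  :: "'e \<Rightarrow> 'v set"

definition loopless_graph :: "('v, 'e) multigraph \<Rightarrow> bool" where
  "loopless_graph G \<longleftrightarrow>
     finite (verts G) \<and> finite (edges G) \<and>
     (\<forall>e\<in>edges G. ends G e \<subseteq> verts G \<and> card (ends G e) = 2)"

definition degree :: "('v, 'e) multigraph \<Rightarrow> 'v \<Rightarrow> nat" where
  "degree G v = card {e \<in> edges G. v \<in> ends G e}"

definition max_degree :: "('v, 'e) multigraph \<Rightarrow> nat" where
  "max_degree G = Max (degree G ` verts G)"

definition adj :: "('v, 'e) multigraph \<Rightarrow> ('v \<times> 'v) set" where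
  "adj G = {(u, v). \<exists>e\<in>edges G. ends G e = {u, v}}"

definition reach :: "('v, 'e) multigraph \<Rightarrow> ('v \<times> 'v) set" where
  "reach G = {(u, v). u \<in> verts G \<and> v \<in> verts G \<and> (u, v) \<in> (adj G)\<^sup>*}"

definition connected_graph :: "('v, 'e) multigraph \<Rightarrow> bool" where
  "connected_graph G \<longleftrightarrow> verts G \<noteq> {} \<and> (\<forall>u\<in>verts G. \<forall>v\<in>verts G. (u, v) \<in> reach G)"

definition induced_subgraph :: "('v, 'e) multigraph \<Rightarrow> 'v set \<Rightarrow> ('v, 'e) multigraph" where
  "induced_subgraph G X =
     \<lparr>verts = verts G \<inter> X, edges = {e \<in> edges G. ends G e \<subseteq> X}, ends = ends G\<rparr>"

definition delete_verts :: "('v, 'e) multigraph \<Rightarrow> 'v set \<Rightarrow> ('v, 'e) multigraph" where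
  "delete_verts G X = induced_subgraph G (verts G - X)"

definition components :: "('v, 'e) multigraph \<Rightarrow> ('v, 'e) multigraph set" where
  "components G = induced_subgraph G ` (verts G // reach G)"

definition odd_components :: "('v, 'e) multigraph \<Rightarrow> ('v, 'e) multigraph set" where
  "odd_components G = {L \<in> components G. odd (card (verts L))}"

definition perfect_matching :: "('v, 'e) multigraph \<Rightarrow> 'e set \<Rightarrow> bool" where
  "perfect_matching G M \<longleftrightarrow> M \<subseteq> edges G \<and> (\<forall>v\<in>verts G. \<exists>!e. e \<in> M \<and> v \<in> ends G e)"

definition matching_covered :: "('v, 'e) multigraph \<Rightarrow> bool" where
  "matching_covered G \<longleftrightarrow>
     loopless_graph G \<and> connected_graph G \<and> 2 \<le> card (verts G) \<and>
     (\<forall>e\<in>edges G. \<exists>M. perfect_matching G M \<and> e \<in> M)"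

definition barrier :: "('v, 'e) multigraph \<Rightarrow> 'v set \<Rightarrow> bool" where
  "barrier G B \<longleftrightarrow>
     (\<exists>M. perfect_matching G M) \<and> B \<subseteq> verts G \<and>
     card (odd_components (delete_verts G B)) = card B"

text \<open>Shrinking \<open>Y\<close> to the single vertex \<open>None\<close>: edges with both ends in \<open>Y\<close> would become loops and
  disappear, all other edges are kept (possibly becoming parallel). The vertex set is an image,
  so shrinking the empty set adds no vertex and gives a copy of the graph.\<close>

definition shrink_map :: "'v set \<Rightarrow> 'v \<Rightarrow> 'v option" where
  "shrink_map Y v = (if v \<in> Y then None else Some v)"

definition shrink :: "('v, 'e) multigraph \<Rightarrow> 'v set \<Rightarrow> ('v option, 'e) multigraph" where
  "shrink G Y =
     \<lparr>verts = shrink_map Y ` verts G,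
      edges = {e \<in> edges G. \<not> ends G e \<subseteq> Y},
      ends = (\<lambda>e. shrink_map Y ` ends G e)\<rparr>"

definition subgraph :: "('v, 'e) multigraph \<Rightarrow> ('v, 'e) multigraph \<Rightarrow> bool" where
  "subgraph H G \<longleftrightarrow>
     loopless_graph H \<and> verts H \<subseteq> verts G \<and> edges H \<subseteq> edges G \<and>
     (\<forall>e\<in>edges H. ends H e = ends G e)"

definition conformal :: "('v, 'e) multigraph \<Rightarrow> ('v, 'e) multigraph \<Rightarrow> bool" where
  "conformal H G \<longleftrightarrow>
     subgraph H G \<and> (\<exists>M. perfect_matching (delete_verts G (verts H)) M)"

text \<open>A path is given by its vertex sequence together with its edge sequence, since the former
  does not determine the latter in the presence of parallel edges.\<close>

definition is_path :: "('v, 'e) multigraph \<Rightarrow> 'v list \<Rightarrow> 'e list \<Rightarrow> bool" where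
  "is_path G vs es \<longleftrightarrow>
     length vs = Suc (length es) \<and> distinct vs \<and>
     set vs \<subseteq> verts G \<and> set es \<subseteq> edges G \<and>
     (\<forall>i<length es. ends G (es ! i) = {vs ! i, vs ! Suc i})"

definition internal_verts :: "'v list \<Rightarrow> 'v list" where
  "internal_verts vs = butlast (tl vs)"

text \<open>\<open>H\<close> arises from \<open>J\<close> (up to renaming vertices by \<open>\<phi>\<close> and edges) by replacing every edge \<open>e\<close> of
  \<open>J\<close> by the path \<open>(pv e, pe e)\<close>; an edge that is left alone corresponds to a path without internal
  vertices. Edge-disjointness must be required separately: paths without internal vertices that
  replace parallel edges of \<open>J\<close> could otherwise coincide.\<close>

definition bisubdivision :: "('v, 'e) multigraph \<Rightarrow> ('w, 'f) multigraph \<Rightarrow> bool" where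
  "bisubdivision H J \<longleftrightarrow>
     (\<exists>(\<phi> :: 'w \<Rightarrow> 'v) (pv :: 'f \<Rightarrow> 'v list) (pe :: 'f \<Rightarrow> 'e list).
        inj_on \<phi> (verts J) \<and>
        (\<forall>e\<in>edges J.
           is_path H (pv e) (pe e) \<and>
           {hd (pv e), last (pv e)} = \<phi> ` ends J e \<and>
           even (length (internal_verts (pv e))) \<and>
           set (internal_verts (pv e)) \<inter> \<phi> ` verts J = {}) \<and>
        (\<forall>e\<in>edges J. \<forall>f\<in>edges J. e \<noteq> f \<longrightarrow>
           set (internal_verts (pv e)) \<inter> set (internal_verts (pv f)) = {} \<and>
           set (pe e) \<inter> set (pe f) = {}) \<and>
        verts H = \<phi> ` verts J \<union> (\<Union>e\<in>edges J. set (internal_verts (pv e))) \<and>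
        edges H = (\<Union>e\<in>edges J. set (pe e)))"

definition based :: "('w, 'f) multigraph \<Rightarrow> ('v, 'e) multigraph \<Rightarrow> bool" where
  "based J G \<longleftrightarrow> (\<exists>H. conformal H G \<and> bisubdivision H J)"

end

theory Submission
  imports Defs
begin

text \<open>Let \<open>C = V(L)\<close> and \<open>S = V(G) - C\<close>. Counting odd components shows that every edge from \<open>C\<close> to
  \<open>S\<close> ends in some \<open>b \<in> B\<close> for which \<open>S - b\<close> is matchable, and that \<open>S\<close> minus two or more vertices
  of \<open>B\<close> is never matchable. As \<open>J\<close> has maximum degree at most 3, a bisubdivision \<open>H\<close> of \<open>J\<close> in the
  contraction uses at most three edges at the contracted vertex. Superposing the matchings of the
  sets \<open>S - b\<^sub>i\<close> for their ends \<open>b\<^sub>i\<close> yields an alternating path from \<open>b\<^sub>2\<close> to \<open>b\<^sub>1\<close> with an odd number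
  of vertices and an alternating ear from \<open>b\<^sub>3\<close> to a vertex \<open>x\<close> of this path, the rest of \<open>S\<close> being
  matched. If \<open>x\<close> sat at the wrong parity on the path, \<open>S - {b\<^sub>1, b\<^sub>2, b\<^sub>3}\<close> would be matchable; so \<open>x\<close>
  can take over the role of the contracted vertex.\<close>

section \<open>Matchable vertex sets\<close>

text \<open>Both facts about \<open>S\<close> come from one count. A perfect matching sends each odd
  component of \<open>G - B\<close> into \<open>B\<close> through an edge of its own, and equality
  in the definition of a barrier leaves no vertex of \<open>B\<close> over. So every vertex of
  \<open>B\<close> is matched into exactly one odd component, and at most one matching edge leaves
  \<open>C\<close>. Once two vertices of \<open>B\<close> are removed from \<open>S\<close>, the |B|
  - 1 odd components other than \<open>C\<close> have too few partners. An even \<open>C\<close> has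
  no edge leaving it, and connectedness makes \<open>S\<close> empty. Paths with an odd number of
  vertices are wanted because one of them in place of the contracted vertex keeps the parity of a
  path of \<open>H\<close>. The degree bound enters because the ear of the third leg chooses the
  branch vertex: a fourth ear could attach elsewhere, and no single vertex would serve all legs. The
  contracted vertex need not be a branch vertex. If it lies inside a subdivided edge, one odd path
  between two barrier vertices suffices; if \<open>H\<close> avoids it, only the matching outside
  \<open>H\<close> has to be extended.\<close>

definition covers_exactly :: "('v, 'e) multigraph \<Rightarrow> 'e set \<Rightarrow> 'v set \<Rightarrow> bool" where
  "covers_exactly G M W \<longleftrightarrow>
     M \<subseteq> edges G \<and> (\<forall>e\<in>M. ends G e \<subseteq> W) \<and> (\<forall>v\<in>W. \<exists>!e. e \<in> M \<and> v \<in> ends G e)"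

text \<open>The matching itself is forgotten on purpose: every later step splits a vertex set into
  disjoint matchable pieces, and only the existence of a matching on each piece matters.\<close>

definition matchable :: "('v, 'e) multigraph \<Rightarrow> 'v set \<Rightarrow> bool" where
  "matchable G W \<longleftrightarrow> (\<exists>M. covers_exactly G M W)"

lemma perfect_matching_induced_iff:
  assumes "X \<subseteq> verts G"
  shows "perfect_matching (induced_subgraph G X) M \<longleftrightarrow> covers_exactly G M X"
  using assms
  by (auto simp: perfect_matching_def induced_subgraph_def covers_exactly_def Int_absorb1)

lemma perfect_matching_delete_iff:
  "(\<exists>M. perfect_matching (delete_verts G X) M) \<longleftrightarrow> matchable G (verts G - X)"
  by (simp add: delete_verts_def matchable_def perfect_matching_induced_iff)

lemma perfect_matching_covers:
  assumes "loopless_graph G"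
  shows "perfect_matching G M \<longleftrightarrow> covers_exactly G M (verts G)"
  using assms by (auto simp: perfect_matching_def covers_exactly_def loopless_graph_def)

lemma matchable_empty: "matchable G {}"
  unfolding matchable_def covers_exactly_def by (rule exI[of _ "{}"]) simp

lemma matchable_Un:
  assumes "matchable G A" "matchable G B" "A \<inter> B = {}"
  shows "matchable G (A \<union> B)"
proof -
  obtain M where M: "covers_exactly G M A" using assms(1) by (auto simp: matchable_def)
  obtain N where N: "covers_exactly G N B" using assms(2) by (auto simp: matchable_def)
  have "covers_exactly G (M \<union> N) (A \<union> B)"
    unfolding covers_exactly_def
  proof (intro conjI ballI)
    show "M \<union> N \<subseteq> edges G" using M N by (auto simp: covers_exactly_def)
    show "ends G e \<subseteq> A \<union> B" if "e \<in> M \<union> N" for e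
      using that M N by (auto simp: covers_exactly_def)
    have 1: "v \<notin> ends G e" if "e \<in> N" "v \<in> A" for e v
      using that N assms(3) unfolding covers_exactly_def by blast
    have 2: "v \<notin> ends G e" if "e \<in> M" "v \<in> B" for e v
      using that M assms(3) unfolding covers_exactly_def by blast
    show "\<exists>!e. e \<in> M \<union> N \<and> v \<in> ends G e" if "v \<in> A \<union> B" for v
    proof (cases "v \<in> A")
      case True
      then have "\<exists>!e. e \<in> M \<and> v \<in> ends G e" using M by (auto simp: covers_exactly_def)
      then show ?thesis using 1 True by blast
    next
      case False
      with that have "v \<in> B" by simp
      then have "\<exists>!e. e \<in> N \<and> v \<in> ends G e" using N by (auto simp: covers_exactly_def)
      then show ?thesis using 2 \<open>v \<in> B\<close> by blast
    qed
  qed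
  then show ?thesis by (auto simp: matchable_def)
qed

lemma matchable_edge:
  assumes "e \<in> edges G" "ends G e = {u, v}"
  shows "matchable G {u, v}"
  unfolding matchable_def covers_exactly_def by (rule exI[of _ "{e}"]) (use assms in auto)

lemma covers_exactly_unique:
  assumes "covers_exactly G M W" "e \<in> M" "f \<in> M" "v \<in> ends G e" "v \<in> ends G f"
  shows "e = f"
proof -
  have "v \<in> W" using assms unfolding covers_exactly_def by blast
  then have "\<exists>!e. e \<in> M \<and> v \<in> ends G e" using assms(1) by (simp add: covers_exactly_def)
  then show ?thesis using assms by blast
qed

text \<open>Serves in two ways: to cut a matching down after some of its edges are discarded, and,
  read backwards, to show that an edge of the matching leaves \<open>K\<close> whenever
  \<open>K\<close> is odd.\<close>

lemma covers_exactly_restrict: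
  assumes M: "covers_exactly G M W" and "K \<subseteq> W"
    and closed: "\<And>e. e \<in> M \<Longrightarrow> ends G e \<inter> K \<noteq> {} \<Longrightarrow> ends G e \<subseteq> K"
  shows "covers_exactly G {e \<in> M. ends G e \<subseteq> K} K"
  unfolding covers_exactly_def
proof (intro conjI ballI)
  show "{e \<in> M. ends G e \<subseteq> K} \<subseteq> edges G" using M by (auto simp: covers_exactly_def)
  show "ends G e \<subseteq> K" if "e \<in> {e \<in> M. ends G e \<subseteq> K}" for e using that by simp
  show "\<exists>!e. e \<in> {e \<in> M. ends G e \<subseteq> K} \<and> v \<in> ends G e" if "v \<in> K" for v
  proof -
    have "\<exists>!e. e \<in> M \<and> v \<in> ends G e" using M that \<open>K \<subseteq> W\<close> unfolding covers_exactly_def by blast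
    then show ?thesis using closed that by blast
  qed
qed

lemma loopless_other_end:
  assumes "loopless_graph G" "e \<in> edges G" "v \<in> ends G e"
  obtains u where "ends G e = {v, u}" "u \<noteq> v"
proof -
  have "card (ends G e) = 2" using assms by (auto simp: loopless_graph_def)
  then obtain a b where "ends G e = {a, b}" "a \<noteq> b" by (auto simp: card_2_iff)
  with assms(3) that show thesis by auto
qed

lemma covers_exactly_partner:
  assumes G: "loopless_graph G" and M: "covers_exactly G M W" and v: "v \<in> W"
  obtains e u where "e \<in> M" "ends G e = {v, u}" "u \<noteq> v" "u \<in> W"
proof -
  from M v obtain e where e: "e \<in> M" "v \<in> ends G e" unfolding covers_exactly_def by blast
  moreover have "e \<in> edges G" "ends G e \<subseteq> W" using M e by (auto simp: covers_exactly_def)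
  moreover obtain u where "ends G e = {v, u}" "u \<noteq> v"
    using loopless_other_end[OF G] e \<open>e \<in> edges G\<close> by metis
  ultimately show thesis using that by auto
qed

text \<open>Peeling off one edge and forgetting the rest is the induction step both for the parity
  of matchable sets and for alternating paths, where two matchings are consumed in turn.\<close>

lemma matchable_partner:
  assumes G: "loopless_graph G" and W: "matchable G W" and v: "v \<in> W"
  obtains e u where "e \<in> edges G" "ends G e = {v, u}" "u \<noteq> v" "u \<in> W" "matchable G (W - {v, u})"
proof -
  obtain M where M: "covers_exactly G M W" using W by (auto simp: matchable_def)
  from covers_exactly_partner[OF G M v]
  obtain e u where e: "e \<in> M" "ends G e = {v, u}" "u \<noteq> v" "u \<in> W" .
  have "ends G f \<subseteq> W - {v, u}" if f: "f \<in> M" "ends G f \<inter> (W - {v, u}) \<noteq> {}" for f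
  proof -
    have "f \<noteq> e" using f e by auto
    then have "ends G f \<inter> ends G e = {}" using covers_exactly_unique[OF M] f e(1) by blast
    moreover have "ends G f \<subseteq> W" using M f by (auto simp: covers_exactly_def)
    ultimately show ?thesis using e(2) by auto
  qed
  then have "matchable G (W - {v, u})"
    using covers_exactly_restrict[OF M, of "W - {v, u}"] by (auto simp: matchable_def)
  moreover have "e \<in> edges G" using M e by (auto simp: covers_exactly_def)
  ultimately show thesis using that e by blast
qed

lemma matchable_even_card:
  assumes "loopless_graph G" "finite W" "matchable G W"
  shows "even (card W)"
  using assms(2,3)
proof (induction "card W" arbitrary: W rule: less_induct)
  case less
  show ?case
  proof (cases "W = {}")
    case False
    then obtain v where v: "v \<in> W" by auto
    from matchable_partner[OF assms(1) less.prems(2) v]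
    obtain e u where u: "u \<noteq> v" "u \<in> W" "matchable G (W - {v, u})" by metis
    have c: "card W = card (W - {v, u}) + 2"
    proof -
      have "card {v, u} = 2" "{v, u} \<subseteq> W" using u v by auto
      then show ?thesis using card_Diff_subset[of "{v,u}" W] card_mono[of W "{v,u}"] less.prems(1)
        by simp
    qed
    have "even (card (W - {v, u}))" using less.hyps[of "W - {v, u}"] less.prems u c by simp
    then show ?thesis using c by simp
  qed simp
qed

section \<open>Paths\<close>

lemma is_path_Nil [simp]: "\<not> is_path G [] es"
  by (simp add: is_path_def)

lemma is_path_singleton [simp]: "is_path G [v] es \<longleftrightarrow> v \<in> verts G \<and> es = []"
  by (auto simp: is_path_def)

lemma is_path_Cons_Cons:
  "is_path G (u # v # vs) es \<longleftrightarrow>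
     (\<exists>e es'. es = e # es' \<and> e \<in> edges G \<and> ends G e = {u, v} \<and> u \<in> verts G \<and> u \<notin> set (v # vs) \<and>
        is_path G (v # vs) es')"
  (is "?l \<longleftrightarrow> ?r")
proof
  assume l: ?l
  then obtain e es' where es: "es = e # es'" by (cases es) (auto simp: is_path_def)
  have "ends G ((e # es') ! i) = {(u # v # vs) ! i, (u # v # vs) ! Suc i}" if "i < Suc (length es')" for i
    using l es that by (auto simp: is_path_def)
  from this[of 0] this[of "Suc _"]
  have "ends G e = {u, v}" "\<forall>i<length es'. ends G (es' ! i) = {(v # vs) ! i, (v # vs) ! Suc i}"
    by auto
  then show ?r using l es by (auto simp: is_path_def)
next
  assume ?r
  then obtain e es' where r: "es = e # es'" "e \<in> edges G" "ends G e = {u, v}" "u \<in> verts G"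
    "u \<notin> set (v # vs)" "is_path G (v # vs) es'" by blast
  have "ends G (es ! i) = {(u # v # vs) ! i, (u # v # vs) ! Suc i}" if "i < length es" for i
    using r that by (cases i) (auto simp: is_path_def)
  then show ?l using r by (auto simp: is_path_def)
qed

lemma is_path_not_Nil: "is_path G vs es \<Longrightarrow> vs \<noteq> []"
  by auto

lemma is_path_verts: "is_path G vs es \<Longrightarrow> set vs \<subseteq> verts G"
  by (simp add: is_path_def)

lemma is_path_distinct: "is_path G vs es \<Longrightarrow> distinct vs"
  by (simp add: is_path_def)

lemma is_path_edges: "is_path G vs es \<Longrightarrow> set es \<subseteq> edges G"
  by (simp add: is_path_def)

lemma is_path_ends:
  assumes "is_path G vs es" "e \<in> set es"
  shows "ends G e \<subseteq> set vs"
proof -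
  obtain i where i: "i < length es" "es ! i = e" using assms(2) by (auto simp: in_set_conv_nth)
  then have "ends G e = {vs ! i, vs ! Suc i}" "Suc i < length vs"
    using assms(1) by (auto simp: is_path_def)
  then show ?thesis by auto
qed

lemma is_path_mono:
  assumes "is_path G vs es" "set vs \<subseteq> verts H" "set es \<subseteq> edges H"
    "\<And>e. e \<in> set es \<Longrightarrow> ends H e = ends G e"
  shows "is_path H vs es"
  using assms by (auto simp: is_path_def)

lemma is_path_append:
  assumes "is_path G vs es" "is_path G ws fs" "set vs \<inter> set ws = {}"
    "e \<in> edges G" "ends G e = {last vs, hd ws}"
  shows "is_path G (vs @ ws) (es @ e # fs)"
  using assms
proof (induction vs arbitrary: es)
  case (Cons u vs)
  show ?case
  proof (cases vs)
    case Nil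
    with Cons.prems show ?thesis by (cases ws) (auto simp: is_path_Cons_Cons)
  next
    case (Cons v vs')
    with Cons.prems(1) obtain f es' where f: "es = f # es'" "f \<in> edges G" "ends G f = {u, v}"
      "u \<in> verts G" "u \<notin> set (v # vs')" "is_path G (v # vs') es'"
      by (auto simp: is_path_Cons_Cons)
    have "is_path G (vs @ ws) (es' @ e # fs)"
      using Cons.IH[of es'] Cons.prems f Cons by auto
    then show ?thesis using f Cons Cons.prems(3) by (auto simp: is_path_Cons_Cons)
  qed
qed simp

lemma is_path_split:
  assumes "is_path G (vs @ ws) es" "vs \<noteq> []" "ws \<noteq> []"
  shows "\<exists>es1 e es2. es = es1 @ e # es2 \<and> is_path G vs es1 \<and> is_path G ws es2 \<and>
    e \<in> edges G \<and> ends G e = {last vs, hd ws}"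
  using assms
proof (induction vs arbitrary: es)
  case (Cons u vs)
  show ?case
  proof (cases vs)
    case Nil
    then obtain w ws' where "ws = w # ws'" using Cons.prems by (cases ws) auto
    with Cons.prems Nil obtain e es' where "es = [] @ e # es'" "e \<in> edges G" "ends G e = {u, w}"
      "is_path G ws es'" "u \<in> verts G" by (auto simp: is_path_Cons_Cons)
    then show ?thesis using Nil \<open>ws = w # ws'\<close>
      by (intro exI[of _ "[]"] exI[of _ e] exI[of _ es']) auto
  next
    case (Cons v vs')
    with Cons.prems(1) obtain f es' where f: "es = f # es'" "f \<in> edges G" "ends G f = {u, v}"
      "u \<in> verts G" "u \<notin> set (v # vs')" "is_path G (vs @ ws) es'"
      by (auto simp: is_path_Cons_Cons)
    from Cons.IH[OF f(6)] Cons Cons.prems obtain es1 e es2 where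
      "es' = es1 @ e # es2" "is_path G vs es1" "is_path G ws es2" "e \<in> edges G"
      "ends G e = {last vs, hd ws}" by auto
    then show ?thesis using f Cons
      by (intro exI[of _ "f # es1"] exI[of _ e] exI[of _ es2]) (auto simp: is_path_Cons_Cons)
  qed
qed simp

lemma is_path_prefix:
  assumes "is_path G (vs @ ws) es" "vs \<noteq> []"
  shows "\<exists>es. is_path G vs es"
  using assms is_path_split[OF assms] by (cases "ws = []") auto

lemma is_path_suffix:
  assumes "is_path G (vs @ ws) es" "ws \<noteq> []"
  shows "\<exists>es. is_path G ws es"
  using assms is_path_split[OF assms(1) _ assms(2)] by (cases "vs = []") auto

lemma is_path_rev:
  assumes "is_path G vs es"
  shows "is_path G (rev vs) (rev es)"
  using assms
proof (induction vs arbitrary: es)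
  case (Cons u vs)
  show ?case
  proof (cases vs)
    case Nil
    with Cons.prems show ?thesis by simp
  next
    case (Cons v vs')
    with Cons.prems obtain f es' where f: "es = f # es'" "f \<in> edges G" "ends G f = {u, v}"
      "u \<in> verts G" "u \<notin> set (v # vs')" "is_path G (v # vs') es'"
      by (auto simp: is_path_Cons_Cons)
    have "is_path G (rev vs @ [u]) (rev es' @ f # [])"
    proof (rule is_path_append)
      show "is_path G (rev vs) (rev es')" using Cons.IH f Cons by auto
    qed (use f Cons in \<open>auto simp: last_rev\<close>)
    then show ?thesis using f Cons by simp
  qed
qed simp

text \<open>The parities need each other: an even path takes its first edge and is left with an odd
  path without its head, and an odd path without its head is an even path.\<close>

lemma is_path_matchable:
  assumes "is_path G vs es"
  shows "even (length vs) \<Longrightarrow> matchable G (set vs)"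
    and "odd (length vs) \<Longrightarrow> matchable G (set (tl vs))"
  using assms
proof (induction vs arbitrary: es)
  case Nil
  { case 1 then show ?case by simp }
  { case 2 then show ?case by simp }
next
  case (Cons u vs)
  {
    case 1
    then obtain v vs' where vs: "vs = v # vs'" by (cases vs) auto
    with 1 obtain f es' where f: "f \<in> edges G" "ends G f = {u, v}"
      "u \<notin> set (v # vs')" "is_path G vs es'" by (auto simp: is_path_Cons_Cons)
    have "matchable G (set vs')" using Cons.IH(2)[OF _ f(4)] 1 vs by simp
    moreover have "{u, v} \<inter> set vs' = {}" using is_path_distinct[OF f(4)] f vs by auto
    ultimately have "matchable G ({u, v} \<union> set vs')"
      using matchable_edge[OF f(1,2)] matchable_Un by blast
    then show ?case by (simp add: vs insert_commute)
  }
  {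
    case 2
    show ?case
    proof (cases vs)
      case Nil
      then show ?thesis by (simp add: matchable_empty)
    next
      case (Cons v vs')
      then obtain es' where "is_path G vs es'" using 2 by (auto simp: is_path_Cons_Cons)
      then show ?thesis using Cons.IH(1) 2 by simp
    qed
  }
qed

lemma is_path_odd_matchable:
  assumes "is_path G vs es" "odd (length vs)"
  shows "matchable G (set vs - {hd vs})" "matchable G (set vs - {last vs})"
proof -
  have *: "matchable G (set vs - {hd vs})" if "is_path G vs es" "odd (length vs)" for vs es
  proof -
    have "set (tl vs) = set vs - {hd vs}"
      using is_path_distinct[OF that(1)] is_path_not_Nil[OF that(1)] by (cases vs) auto
    then show ?thesis using is_path_matchable(2)[OF that] by simp
  qed
  show "matchable G (set vs - {hd vs})" by (rule *) fact+
  show "matchable G (set vs - {last vs})"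
    using *[OF is_path_rev[OF assms(1)]] assms(2) by (simp add: hd_rev)
qed

text \<open>The path alternates between the given matchings of \<open>S - P\<close> and of \<open>S - {b}\<close>, starting with
  an edge of the former; it can first meet \<open>P\<close> only through an edge of the latter.\<close>

lemma alternating_ear:
  assumes G: "loopless_graph G" and "finite S" "S \<subseteq> verts G" "P \<subseteq> S" "b \<in> S"
    "matchable G (S - P)" "matchable G (S - {b})"
  shows "\<exists>vs es. is_path G vs es \<and> hd vs = b \<and> set vs \<subseteq> S \<and> odd (length vs) \<and>
    set vs \<inter> P = {last vs} \<and> matchable G (S - P - set vs)"
  using assms(2-)
proof (induction "card S" arbitrary: S b rule: less_induct)
  case less
  show ?case
  proof (cases "b \<in> P")
    case True
    then have "S - P - {b} = S - P" by auto
    then show ?thesis using True less.prems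
      by (intro exI[of _ "[b]"] exI[of _ "[]"]) auto
  next
    case False
    with less.prems have "b \<in> S - P" by simp
    from matchable_partner[OF G less.prems(5) this] obtain e c where
      c: "e \<in> edges G" "ends G e = {b, c}" "c \<noteq> b" "c \<in> S - P" "matchable G (S - P - {b, c})" .
    \<comment> \<open>The second matching misses \<open>b\<close>, so the partner \<open>d\<close>
      of \<open>c\<close> under it is a new vertex from which the path can go on.\<close>
    then have "c \<in> S - {b}" by simp
    from matchable_partner[OF G less.prems(6) this] obtain f d where
      d: "f \<in> edges G" "ends G f = {c, d}" "d \<noteq> c" "d \<in> S - {b}" "matchable G (S - {b} - {c, d})" .
    let ?S = "S - {b, c}"
    \<comment> \<open>Both hypotheses survive on \<open>?S\<close>: the first matching loses the
      edge \<open>bc\<close>, the second loses \<open>cd\<close> and now misses \<open>d\<close>.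
      \<open>P\<close> is untouched because \<open>b\<close> and \<open>c\<close> lie outside
      it.\<close>
    have "card ?S < card S" using less.prems by (intro psubset_card_mono) auto
    moreover have "finite ?S" "?S \<subseteq> verts G" "P \<subseteq> ?S" "?S - P = S - P - {b, c}" "?S - {d} = S - {b} - {c, d}" "d \<in> ?S"
      using less.prems c d False by auto
    ultimately obtain vs es where vs: "is_path G vs es" "hd vs = d" "set vs \<subseteq> ?S" "odd (length vs)"
      "set vs \<inter> P = {last vs}" "matchable G (?S - P - set vs)"
      using less.hyps[of ?S d] c(5) d(5) by metis
    obtain vs' where vs': "vs = d # vs'" using vs by (cases vs) auto
    have "is_path G (b # c # vs) (e # f # es)"
      using vs(1,3) c d less.prems unfolding vs' by (auto simp: is_path_Cons_Cons)
    moreover have "S - P - set (b # c # vs) = ?S - P - set vs" by auto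
    ultimately show ?thesis using vs c False less.prems vs'
      by (intro exI[of _ "b # c # vs"] exI[of _ "e # f # es"]) auto
  qed
qed

section \<open>Counting odd components\<close>

text \<open>Odd components as vertex sets instead of graphs, so that disjointness and counting are
  statements about sets of sets.\<close>

definition odd_classes :: "('v, 'e) multigraph \<Rightarrow> 'v set \<Rightarrow> 'v set set" where
  "odd_classes G B =
     {K \<in> verts (delete_verts G B) // reach (delete_verts G B). odd (card K)}"

lemma verts_delete [simp]: "verts (delete_verts G B) = verts G - B"
  by (auto simp: delete_verts_def induced_subgraph_def)

lemma edges_delete [simp]: "edges (delete_verts G B) = {e \<in> edges G. ends G e \<subseteq> verts G - B}"
  by (auto simp: delete_verts_def induced_subgraph_def)

lemma ends_delete [simp]: "ends (delete_verts G B) = ends G"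
  by (auto simp: delete_verts_def induced_subgraph_def)

lemma sym_adj: "sym (adj G)"
  by (auto simp: sym_def adj_def insert_commute)

lemma equiv_reach: "equiv (verts G) (reach G)"
proof (rule equivI)
  show "reach G \<subseteq> verts G \<times> verts G" by (auto simp: reach_def)
  show "refl_on (verts G) (reach G)" by (auto simp: refl_on_def reach_def)
  show "sym (reach G)" using sym_rtrancl[OF sym_adj[of G]] by (auto simp: reach_def sym_def)
  show "trans (reach G)" by (auto simp: trans_def reach_def)
qed

lemma class_subset:
  assumes "K \<in> verts (delete_verts G B) // reach (delete_verts G B)"
  shows "K \<subseteq> verts G - B"
  using in_quotient_imp_subset[OF equiv_reach assms] by simp

lemma class_disjoint:
  assumes "K \<in> verts (delete_verts G B) // reach (delete_verts G B)"
    "K' \<in> verts (delete_verts G B) // reach (delete_verts G B)" "v \<in> K" "v \<in> K'"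
  shows "K = K'"
  using quotient_disj[OF equiv_reach assms(1,2)] assms(3,4) by blast

text \<open>Two adjacent vertices outside \<open>B\<close> are reachable from each other in
  \<open>G - B\<close> and so share a class.\<close>

lemma class_boundary:
  assumes K: "K \<in> verts (delete_verts G B) // reach (delete_verts G B)"
    and "e \<in> edges G" "ends G e = {a, b}" "a \<in> K" "b \<in> verts G" "b \<notin> K"
  shows "b \<in> B"
proof (rule ccontr)
  assume "b \<notin> B"
  moreover have "a \<in> verts G - B" using class_subset[OF K] \<open>a \<in> K\<close> by auto
  ultimately have "(a, b) \<in> adj (delete_verts G B)"
    using assms(2,3,5) by (auto simp: adj_def)
  then have "(a, b) \<in> reach (delete_verts G B)"
    using \<open>a \<in> verts G - B\<close> \<open>b \<notin> B\<close> assms(5) by (auto simp: reach_def)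
  then show False
    using in_quotient_imp_closed[OF equiv_reach K] assms by blast
qed

lemma verts_induced_class:
  assumes "K \<in> verts (delete_verts G B) // reach (delete_verts G B)"
  shows "verts (induced_subgraph (delete_verts G B) K) = K"
  using class_subset[OF assms] by (auto simp: induced_subgraph_def)

lemma card_odd_components: "card (odd_components (delete_verts G B)) = card (odd_classes G B)"
proof -
  let ?D = "delete_verts G B"
  have "odd_components ?D = induced_subgraph ?D ` odd_classes G B"
    using verts_induced_class[of _ G B]
    by (fastforce simp: odd_components_def components_def odd_classes_def)
  moreover have "inj_on (induced_subgraph ?D) (odd_classes G B)"
  proof (rule inj_onI)
    fix K K' assume "K \<in> odd_classes G B" "K' \<in> odd_classes G B"
      "induced_subgraph ?D K = induced_subgraph ?D K'"
    then show "K = K'" using verts_induced_class[of _ G B]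
      by (metis (no_types, lifting) mem_Collect_eq odd_classes_def)
  qed
  ultimately show ?thesis by (simp add: card_image)
qed

lemma odd_class_subset: "K \<in> odd_classes G B \<Longrightarrow> K \<subseteq> verts G - B"
  using class_subset[of K G B] by (simp add: odd_classes_def)

text \<open>An odd class cannot be matched within itself, so an edge of \<open>M\<close> leaves it,
  necessarily towards \<open>B\<close>. Two classes with the same end in \<open>B\<close> would
  share that edge and hence a vertex. The sets \<open>W\<close> and \<open>F\<close> are kept free:
  all of \<open>V(G)\<close> with all odd classes gives the unique edge leaving \<open>C\<close>,
  and \<open>S - T\<close> with the classes other than \<open>C\<close> gives the bound on
  \<open>T\<close>.\<close>

lemma odd_classes_into_barrier:
  assumes G: "loopless_graph G" and M: "covers_exactly G M W" and W: "W \<subseteq> verts G"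
    and F: "F \<subseteq> odd_classes G B" "\<Union>F \<subseteq> W"
  shows "\<exists>f. inj_on f F \<and> f ` F \<subseteq> B \<inter> W \<and> (\<forall>K\<in>F. \<exists>e\<in>M. \<exists>k\<in>K. ends G e = {k, f K})"
proof -
  have "\<exists>b. b \<in> B \<inter> W \<and> (\<exists>e\<in>M. \<exists>k\<in>K. ends G e = {k, b})" if "K \<in> F" for K
  proof -
    have K: "K \<in> verts (delete_verts G B) // reach (delete_verts G B)" "odd (card K)" "K \<subseteq> W"
      using that F by (auto simp: odd_classes_def)
    have "finite K" using G K(3) W by (auto simp: loopless_graph_def intro: finite_subset)
    have "\<exists>e\<in>M. ends G e \<inter> K \<noteq> {} \<and> \<not> ends G e \<subseteq> K"
    proof (rule ccontr)
      assume "\<not> ?thesis"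
      then have "matchable G K"
        using covers_exactly_restrict[OF M K(3)] unfolding matchable_def by blast
      then show False using matchable_even_card[OF G \<open>finite K\<close>] K(2) by simp
    qed
    then obtain e k where e: "e \<in> M" "k \<in> K" "k \<in> ends G e" "\<not> ends G e \<subseteq> K" by blast
    have eG: "e \<in> edges G" "ends G e \<subseteq> W" using M e by (auto simp: covers_exactly_def)
    obtain b where b: "ends G e = {k, b}" using loopless_other_end[OF G eG(1) e(3)] by metis
    have "b \<in> W" "b \<notin> K" using b e eG by auto
    then show ?thesis using class_boundary[OF K(1) eG(1) b e(2)] W b e by blast
  qed
  then obtain f where f: "\<And>K. K \<in> F \<Longrightarrow> f K \<in> B \<inter> W"
    "\<And>K. K \<in> F \<Longrightarrow> \<exists>e\<in>M. \<exists>k\<in>K. ends G e = {k, f K}" by metis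
  have "inj_on f F"
  proof (rule inj_onI)
    fix K K' assume K: "K \<in> F" "K' \<in> F" "f K = f K'"
    obtain e k where e: "e \<in> M" "k \<in> K" "ends G e = {k, f K}" using f(2)[OF K(1)] by blast
    obtain e' k' where e': "e' \<in> M" "k' \<in> K'" "ends G e' = {k', f K}" using f(2)[OF K(2)] K by auto
    have "e = e'" using covers_exactly_unique[OF M e(1) e'(1), of "f K"] e e' by simp
    moreover have Q: "K \<in> verts (delete_verts G B) // reach (delete_verts G B)"
      "K' \<in> verts (delete_verts G B) // reach (delete_verts G B)"
      using K F by (auto simp: odd_classes_def)
    moreover have "k \<noteq> f K" "k' \<noteq> f K" using f(1) K class_subset[OF Q(1)] class_subset[OF Q(2)] e e'
      by auto
    ultimately have "k = k'" using e(3) e'(3) by (auto simp: doubleton_eq_iff)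
    then show "K = K'" using class_disjoint[OF Q] e e' by auto
  qed
  then show ?thesis using f by blast
qed

text \<open>As there are as many odd classes as barrier vertices, the injection from odd classes to
  their partners in \<open>B\<close> is onto. Every edge of \<open>M\<close> between
  \<open>C\<close> and \<open>B\<close> therefore ends in the one vertex assigned to
  \<open>C\<close>.\<close>

lemma matching_meets_class_once:
  assumes G: "loopless_graph G" and B: "B \<subseteq> verts G" "card (odd_classes G B) = card B"
    and C: "C \<in> verts (delete_verts G B) // reach (delete_verts G B)"
    and M: "covers_exactly G M (verts G)" and e: "e \<in> M" "ends G e = {a, b}" "a \<in> C" "b \<notin> C"
  shows "b \<in> B" "odd (card C)" "matchable G (verts G - C - {b})"
proof -
  have fin: "finite (verts G)" using G by (simp add: loopless_graph_def)
  then have "finite B" using B finite_subset by blast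
  have sub: "\<Union>(odd_classes G B) \<subseteq> verts G"
    using odd_class_subset by blast
  obtain f where f: "inj_on f (odd_classes G B)" "f ` odd_classes G B \<subseteq> B \<inter> verts G"
    "\<forall>K\<in>odd_classes G B. \<exists>e\<in>M. \<exists>k\<in>K. ends G e = {k, f K}"
    using odd_classes_into_barrier[OF G M order.refl order.refl sub] by (elim exE conjE)
  have onto: "f ` odd_classes G B = B"
    using f(1,2) B \<open>finite B\<close> by (intro card_subset_eq) (auto simp: card_image)
  \<comment> \<open>The end \<open>b'\<close> is the partner of some odd class \<open>K\<close>. The
    edge of \<open>M\<close> at \<open>b'\<close> is unique, so it joins \<open>b'\<close> both to
    \<open>K\<close> and to \<open>C\<close>, which forces \<open>K = C\<close>. In particular
    \<open>C\<close> is odd as soon as an edge of \<open>M\<close> leaves it.\<close>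
  have *: "b' \<in> B \<and> C \<in> odd_classes G B \<and> f C = b'"
    if e': "e' \<in> M" "ends G e' = {a', b'}" "a' \<in> C" "b' \<notin> C" for e' a' b'
  proof -
    have eG: "e' \<in> edges G" "ends G e' \<subseteq> verts G" using M e' by (auto simp: covers_exactly_def)
    then have "b' \<in> verts G" using e'(2) by simp
    then have b': "b' \<in> B" by (rule class_boundary[OF C eG(1) e'(2,3) _ e'(4)])
    then have "b' \<in> f ` odd_classes G B" unfolding onto .
    then obtain K where K: "K \<in> odd_classes G B" "f K = b'" by auto
    obtain e'' k where e'': "e'' \<in> M" "k \<in> K" "ends G e'' = {k, b'}" using bspec[OF f(3) K(1)] K(2) by blast
    have "e'' = e'" using covers_exactly_unique[OF M e''(1) e'(1), of b'] e' e'' by simp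
    moreover have "K \<subseteq> verts G - B" using K odd_class_subset by blast
    ultimately have "k = a'" using e' e'' b' by (auto simp: doubleton_eq_iff)
    then have "K = C" using class_disjoint[OF _ C, of K k] K e'' e' by (auto simp: odd_classes_def)
    then show ?thesis using K b' by simp
  qed
  from *[OF e] show "b \<in> B" "odd (card C)" by (auto simp: odd_classes_def)
  \<comment> \<open>\<open>M\<close> restricts to this set: an edge from it into \<open>C\<close>
    would have \<open>f C = b\<close> as its other end, and the edge of \<open>M\<close> at
    \<open>b\<close> already goes into \<open>C\<close>.\<close>
  have "matchable G (verts G - C - {b})"
    unfolding matchable_def
  proof (rule exI, rule covers_exactly_restrict[OF M])
    fix e' assume e': "e' \<in> M" "ends G e' \<inter> (verts G - C - {b}) \<noteq> {}"
    have eG: "e' \<in> edges G" "ends G e' \<subseteq> verts G" using M e' by (auto simp: covers_exactly_def)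
    obtain v where v: "v \<in> ends G e'" "v \<notin> C" "v \<noteq> b" using e' by auto
    obtain u where u: "ends G e' = {v, u}" using loopless_other_end[OF G eG(1) v(1)] by metis
    have "u \<notin> C"
    proof
      assume "u \<in> C"
      then have "f C = v" "f C = b" using *[of e' u v] *[OF e] e' u v by (auto simp: insert_commute)
      then show False using v by simp
    qed
    moreover have "u \<noteq> b"
    proof
      assume "u = b"
      then have "e' = e" using covers_exactly_unique[OF M e'(1) e(1), of b] u e by simp
      then show False using u e v \<open>u \<notin> C\<close> by auto
    qed
    ultimately show "ends G e' \<subseteq> verts G - C - {b}" using u v eG by auto
  qed auto
  then show "matchable G (verts G - C - {b})" .
qed

text \<open>The |B| - 1 odd classes other than \<open>C\<close> lie in the matched set and need
  distinct partners in \<open>B - T\<close>, so |B| - 1 \<le> |B| - |T|.\<close>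

lemma removable_barrier_part:
  assumes G: "loopless_graph G" and B: "B \<subseteq> verts G" "card (odd_classes G B) = card B"
    and C: "C \<in> odd_classes G B"
    and T: "T \<subseteq> B" "matchable G (verts G - C - T)"
  shows "card T \<le> 1"
proof -
  have fin: "finite (verts G)" using G by (simp add: loopless_graph_def)
  then have "finite B" using B finite_subset by blast
  let ?F = "odd_classes G B - {C}" and ?W = "verts G - C - T"
  obtain M where M: "covers_exactly G M ?W" using T by (auto simp: matchable_def)
  have "K \<subseteq> ?W" if "K \<in> ?F" for K
  proof -
    have Q: "K \<in> verts (delete_verts G B) // reach (delete_verts G B)"
      "C \<in> verts (delete_verts G B) // reach (delete_verts G B)" "K \<noteq> C"
      using that C by (auto simp: odd_classes_def)
    then have "K \<inter> C = {}" using class_disjoint[OF Q(1,2)] by blast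
    then show ?thesis using class_subset[OF Q(1)] T by auto
  qed
  then have "\<Union>?F \<subseteq> ?W" by blast
  then obtain f where f: "inj_on f ?F" "f ` ?F \<subseteq> B \<inter> ?W"
    using odd_classes_into_barrier[OF G M, of ?F B] by blast
  have "card ?F \<le> card (B - T)"
  proof (rule card_inj_on_le[OF f(1)])
    show "f ` ?F \<subseteq> B - T" using f(2) by blast
  qed (use \<open>finite B\<close> in simp)
  moreover have "finite T" using T(1) \<open>finite B\<close> by (rule finite_subset)
  then have "card (B - T) = card B - card T" using T(1) by (rule card_Diff_subset)
  moreover have "card T \<le> card B" using \<open>finite B\<close> T(1) by (rule card_mono)
  \<comment> \<open>\<open>C\<close> is itself one of the odd classes counted by |B|, so
    \<open>card B - 1\<close> is a genuine difference of natural numbers.\<close>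
  moreover have "card B \<noteq> 0"
  proof -
    have "odd_classes G B \<subseteq> Pow (verts G)"
      using odd_class_subset by blast
    then have "finite (odd_classes G B)" using fin by (metis finite_Pow_iff finite_subset)
    then have "card (odd_classes G B) > 0" using C card_gt_0_iff by blast
    then show ?thesis using B by simp
  qed
  moreover have "card ?F = card B - 1" using B(2) C by (simp only: card_Diff_singleton)
  ultimately show ?thesis by linarith
qed

section \<open>Three legs meeting in a new branch vertex\<close>

text \<open>In the application \<open>E\<close> consists of the edges of \<open>J\<close> at the
  branch vertex that was contracted, and \<open>b e\<close> is the end in \<open>S\<close> of the
  cut edge used by the path of \<open>e\<close>. Different edges may have the same
  \<open>b e\<close>; a leg can be a single vertex. The vertex \<open>b0\<close> provides
  \<open>x\<close> when \<open>E\<close> is empty.\<close>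

lemma spider_exists:
  assumes G: "loopless_graph G" and S: "finite S" "S \<subseteq> verts G" "B \<subseteq> S"
    and sparse: "\<forall>T. T \<subseteq> B \<longrightarrow> matchable G (S - T) \<longrightarrow> card T \<le> 1"
    and b: "\<forall>e\<in>E. b e \<in> B \<and> matchable G (S - {b e})"
    and E: "finite E" "card E \<le> 3"
    and b0: "b0 \<in> S" "matchable G (S - {b0})"
  shows "\<exists>x\<in>S. \<exists>R RE.
    (\<forall>e\<in>E. is_path G (R e) (RE e) \<and> hd (R e) = x \<and> last (R e) = b e \<and> set (R e) \<subseteq> S \<and>
       odd (length (R e))) \<and>
    (\<forall>e\<in>E. \<forall>f\<in>E. e \<noteq> f \<longrightarrow> set (R e) \<inter> set (R f) \<subseteq> {x}) \<and>
    matchable G (S - ({x} \<union> (\<Union>e\<in>E. set (R e))))"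
proof -
  consider "E = {}" | e1 where "E = {e1}" | e1 e2 where "E = {e1, e2}" "e1 \<noteq> e2"
    | e1 e2 e3 where "E = {e1, e2, e3}" "e1 \<noteq> e2" "e1 \<noteq> e3" "e2 \<noteq> e3"
  proof -
    have "card E = 0 \<or> card E = 1 \<or> card E = 2 \<or> card E = 3" using E by linarith
    then show thesis using E that by (auto simp: card_1_singleton_iff card_2_iff card_3_iff)
  qed
  then show ?thesis
  proof cases
    case 1
    then show ?thesis using b0 by auto
  next
    case 2
    then have "b e1 \<in> S" "matchable G (S - {b e1})" using b S by auto
    then show ?thesis using 2 S
      by (intro bexI[of _ "b e1"] exI[of _ "\<lambda>_. [b e1]"] exI[of _ "\<lambda>_. []"]) auto
  next
    case 3
    then have be: "b e1 \<in> S" "b e2 \<in> S" "matchable G (S - {b e1})" "matchable G (S - {b e2})"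
      using b S by auto
    obtain p pe where p: "is_path G p pe" "hd p = b e2" "set p \<subseteq> S" "odd (length p)"
      "set p \<inter> {b e1} = {last p}" "matchable G (S - {b e1} - set p)"
      using alternating_ear[OF G S(1,2), of "{b e1}" "b e2"] be by auto
    have "last p \<in> set p \<inter> {b e1}" unfolding p(5) by simp
    then have "last p = b e1" "b e1 \<in> set p" by auto
    \<comment> \<open>The vertex \<open>b e1\<close> serves as \<open>x\<close>: its own leg is
      trivial, and the ear from \<open>b e2\<close> is reversed so that it starts there.\<close>
    let ?R = "\<lambda>e. if e = e1 then [b e1] else rev p"
    let ?RE = "\<lambda>e. if e = e1 then [] else rev pe"
    have 1: "is_path G (?R e) (?RE e) \<and> hd (?R e) = b e1 \<and> last (?R e) = b e \<and> set (?R e) \<subseteq> S \<and>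
       odd (length (?R e))" if "e \<in> E" for e
    proof (cases "e = e1")
      case True
      then show ?thesis using be S by auto
    next
      case False
      then have "e = e2" using that 3 by simp
      then show ?thesis
        using False is_path_rev[OF p(1)] p(2-4) \<open>last p = b e1\<close> is_path_not_Nil[OF p(1)]
        by (simp add: hd_rev last_rev)
    qed
    have 2: "set (?R e) \<inter> set (?R f) \<subseteq> {b e1}" if "e \<in> E" "f \<in> E" "e \<noteq> f" for e f
      using that 3 by auto
    have "S - ({b e1} \<union> (\<Union>e\<in>E. set (?R e))) = S - {b e1} - set p"
      using 3 by auto
    then have 3: "matchable G (S - ({b e1} \<union> (\<Union>e\<in>E. set (?R e))))" using p(6) by simp
    show ?thesis
    proof (rule bexI[of _ "b e1"], rule exI[of _ ?R], rule exI[of _ ?RE], rule conjI[OF ballI conjI[OF ballI]])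
      show "\<forall>f\<in>E. e \<noteq> f \<longrightarrow> set (?R e) \<inter> set (?R f) \<subseteq> {b e1}" if "e \<in> E" for e
        using that 2 by blast
    qed (rule 1 3 be(1), assumption?)+
  next
    case 4
    then have be: "b e1 \<in> B" "b e2 \<in> B" "b e3 \<in> B" "b e1 \<in> S" "b e2 \<in> S" "b e3 \<in> S"
      "matchable G (S - {b e1})" "matchable G (S - {b e2})" "matchable G (S - {b e3})"
      using b S by auto
    obtain p pe where p: "is_path G p pe" "hd p = b e2" "set p \<subseteq> S" "odd (length p)"
      "set p \<inter> {b e1} = {last p}" "matchable G (S - {b e1} - set p)"
      using alternating_ear[OF G S(1,2), of "{b e1}" "b e2"] be by auto
    have "last p \<in> set p \<inter> {b e1}" unfolding p(5) by simp
    then have lp: "last p = b e1" "b e1 \<in> set p" by auto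
    then have "S - {b e1} - set p = S - set p" by auto
    then have "matchable G (S - set p)" using p(6) by simp
    \<comment> \<open>The second ear is grown towards the whole path \<open>p\<close>, which is
      possible because \<open>S\<close> minus the vertices of \<open>p\<close> is matchable. Its
      point of attachment becomes \<open>x\<close>.\<close>
    then obtain q qe where q: "is_path G q qe" "hd q = b e3" "set q \<subseteq> S" "odd (length q)"
      "set q \<inter> set p = {last q}" "matchable G (S - set p - set q)"
      using alternating_ear[OF G S(1,2), of "set p" "b e3"] be p(3) by auto
    let ?x = "last q"
    have "?x \<in> set q \<inter> set p" unfolding q(5) by simp
    then have x: "?x \<in> set p" "?x \<in> set q" "?x \<in> S" using p(3) by blast+
    have qp: "v = ?x" if "v \<in> set q" "v \<in> set p" for v
    proof -
      have "v \<in> set q \<inter> set p" using that by simp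
      then show ?thesis unfolding q(5) by simp
    qed
    obtain p1 p2 where p12: "p = p1 @ ?x # p2" by (meson split_list x(1))
    have pp: "is_path G (p1 @ ?x # p2) pe" using p(1) unfolding p12[symmetric] .
    have pl: "odd (length p1 + Suc (length p2))" using p(4) unfolding p12 by simp
    have dist: "distinct p" using is_path_distinct[OF p(1)] .
    have sp: "set p = set p1 \<union> {?x} \<union> set p2" by (auto simp: p12)
    have dj: "set p1 \<inter> set p2 = {}" "?x \<notin> set p1" "?x \<notin> set p2"
      using dist by (auto simp: p12)
    have q12: "set q \<inter> set p1 = {}" "set q \<inter> set p2 = {}" "?x \<in> set q"
      using qp sp dj x(2) by auto
    text \<open>Otherwise cutting off the three ends of the spider would leave \<open>S\<close> minus three barrier
      vertices matchable.\<close>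
    have ev: "even (length p1)"
    proof (rule ccontr)
      assume o1: "odd (length p1)"
      then have o2: "odd (length p2)" using pl by simp
      have ne: "p1 \<noteq> []" "p2 \<noteq> []" using o1 o2 by auto
      obtain es1 es2 where s: "is_path G p1 es1" "is_path G (?x # p2) es2"
        using is_path_prefix[OF pp ne(1)] is_path_suffix[OF pp] by blast
      obtain es3 where s2: "is_path G p2 es3"
        using is_path_suffix[of G "[?x]" p2] s(2) ne(2) by auto
      have h: "hd p1 = b e2" "last p2 = b e1" using p(2) lp(1) ne by (simp_all add: p12)
      have m: "matchable G (set p1 - {b e2})" "matchable G (set p2 - {b e1})"
        "matchable G (set q - {b e3})"
        using is_path_odd_matchable[OF s(1) o1] is_path_odd_matchable[OF s2 o2]
          is_path_odd_matchable[OF q(1,4)] h q(2) by auto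
      have in12: "b e2 \<in> set p1" "b e1 \<in> set p2" using h ne by (metis hd_in_set, metis last_in_set)
      have inq: "b e3 \<in> set q" using hd_in_set[OF is_path_not_Nil[OF q(1)]] q(2) by simp
      let ?T = "{b e1, b e2, b e3}"
      \<comment> \<open>The pieces \<open>p1\<close>, \<open>p2\<close> and \<open>q\<close> all
        have odd length here, so each is matchable once its barrier end is dropped. The vertex
        \<open>x\<close> is counted with \<open>q\<close>, which makes the pieces disjoint.\<close>
      have "matchable G ((set p1 - {b e2}) \<union> (set p2 - {b e1}) \<union> (set q - {b e3}) \<union> (S - set p - set q))"
        using m q(6) dj q12 sp by (intro matchable_Un) auto
      also have "(set p1 - {b e2}) \<union> (set p2 - {b e1}) \<union> (set q - {b e3}) \<union> (S - set p - set q) = S - ?T"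
        using sp dj q12 in12 inq p(3) q(3) by auto
      finally have "card ?T \<le> 1" using spec[OF sparse, of ?T] be by simp
      moreover have "b e1 \<noteq> b e2" using in12 dj by auto
      ultimately show False by (simp add: card_insert_if split: if_splits)
    qed
    then have ev2: "even (length p2)" using pl by simp
    obtain esa where a: "is_path G (?x # p2) esa"
      using is_path_suffix[OF pp] by blast
    obtain esb where bb: "is_path G (p1 @ [?x]) esb"
      using is_path_prefix[of G "p1 @ [?x]" p2] pp by auto
    have h: "hd (p1 @ [?x]) = b e2" "last (?x # p2) = b e1"
      using p(2) lp(1) by (simp_all add: p12 hd_append split: if_splits)
    \<comment> \<open>All legs are directed away from \<open>x\<close>. The first two consist of an
      even part of \<open>p\<close> together with \<open>x\<close>, hence are odd.\<close>
    let ?R = "\<lambda>e. if e = e1 then ?x # p2 else if e = e2 then rev (p1 @ [?x]) else rev q"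
    let ?RE = "\<lambda>e. if e = e1 then esa else if e = e2 then rev esb else rev qe"
    have 1: "is_path G (?R e) (?RE e) \<and> hd (?R e) = ?x \<and> last (?R e) = b e \<and> set (?R e) \<subseteq> S \<and>
       odd (length (?R e))" if "e \<in> E" for e
    proof -
      consider "e = e1" | "e = e2" "e \<noteq> e1" | "e = e3" "e \<noteq> e1" "e \<noteq> e2"
        using \<open>e \<in> E\<close> 4 by blast
      then show ?thesis
      proof cases
        case 1
        then show ?thesis using a h ev2 sp p(3) by simp
      next
        case 2
        then show ?thesis using is_path_rev[OF bb] h ev sp p(3) by (simp add: last_rev hd_append split: if_splits)
      next
        case 3
        then show ?thesis using is_path_rev[OF q(1)] q(2-4) is_path_not_Nil[OF q(1)]
          by (simp add: hd_rev last_rev)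
      qed
    qed
    have 2: "set (?R e) \<inter> set (?R f) \<subseteq> {?x}" if "e \<in> E" "f \<in> E" "e \<noteq> f" for e f
      using that dj q12 unfolding 4(1) by auto
    have "S - ({?x} \<union> (\<Union>e\<in>E. set (?R e))) = S - set p - set q"
      using 4(2-4) sp q12 unfolding 4(1) by auto
    then have 3: "matchable G (S - ({?x} \<union> (\<Union>e\<in>E. set (?R e))))" using q(6) by simp
    show ?thesis
    proof (rule bexI[of _ "?x"], rule exI[of _ ?R], rule exI[of _ ?RE], rule conjI[OF ballI conjI[OF ballI]])
      show "\<forall>f\<in>E. e \<noteq> f \<longrightarrow> set (?R e) \<inter> set (?R f) \<subseteq> {?x}" if "e \<in> E" for e
        using that 2 by blast
    qed (rule 1 3 x(3), assumption?)+
  qed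
qed

section \<open>Bisubdivisions as systems of paths\<close>

text \<open>A bisubdivision inside a host graph, phrased with whole paths instead of internal
  vertices and without the subgraph \<open>H\<close>. The parity is unchanged, since the two ends
  add 2. Conditions on internal vertices turn into the demand that paths meet each other only in
  branch vertices, a form that survives the replacement of parts of paths.\<close>

definition path_model ::
    "('v, 'e) multigraph \<Rightarrow> ('w, 'f) multigraph \<Rightarrow> ('w \<Rightarrow> 'v) \<Rightarrow> ('f \<Rightarrow> 'v list) \<Rightarrow> ('f \<Rightarrow> 'e list) \<Rightarrow> bool"
  where
  "path_model G J \<phi> pv pe \<longleftrightarrow>
     inj_on \<phi> (verts J) \<and> \<phi> ` verts J \<subseteq> verts G \<and>
     (\<forall>e\<in>edges J. is_path G (pv e) (pe e) \<and> {hd (pv e), last (pv e)} = \<phi> ` ends J e \<and>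
        even (length (pv e)) \<and> set (pv e) \<inter> \<phi> ` verts J \<subseteq> \<phi> ` ends J e) \<and>
     (\<forall>e\<in>edges J. \<forall>f\<in>edges J. e \<noteq> f \<longrightarrow>
        set (pv e) \<inter> set (pv f) \<subseteq> \<phi> ` verts J \<and> set (pe e) \<inter> set (pe f) = {})"

definition model_verts :: "('w, 'f) multigraph \<Rightarrow> ('w \<Rightarrow> 'v) \<Rightarrow> ('f \<Rightarrow> 'v list) \<Rightarrow> 'v set" where
  "model_verts J \<phi> pv = \<phi> ` verts J \<union> (\<Union>e\<in>edges J. set (pv e))"

lemma internal_verts_path:
  assumes "is_path G vs es" "hd vs \<noteq> last vs"
  shows "set (internal_verts vs) = set vs - {hd vs, last vs}"
    and "length vs = length (internal_verts vs) + 2"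
proof -
  obtain u ws where u: "vs = u # ws" using is_path_not_Nil[OF assms(1)] by (cases vs) auto
  have "ws \<noteq> []" using u assms(2) by auto
  then obtain xs v where v: "ws = xs @ [v]" by (metis rev_exhaust)
  show "set (internal_verts vs) = set vs - {hd vs, last vs}"
    "length vs = length (internal_verts vs) + 2"
    using is_path_distinct[OF assms(1)] unfolding u v internal_verts_def by auto
qed

lemma inj_on_ends_neq:
  assumes "loopless_graph J" "inj_on \<phi> (verts J)" "e \<in> edges J" "{a, b} = \<phi> ` ends J e"
  shows "a \<noteq> b"
proof -
  have "card (ends J e) = 2" "ends J e \<subseteq> verts J" using assms(1,3) by (auto simp: loopless_graph_def)
  then obtain u v where uv: "ends J e = {u, v}" "u \<noteq> v" "u \<in> verts J" "v \<in> verts J"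
    by (auto simp: card_2_iff)
  then have "\<phi> u \<noteq> \<phi> v" using assms(2) by (auto dest: inj_onD)
  then show ?thesis using assms(4) uv by (auto simp: doubleton_eq_iff)
qed

lemma Int_subset_if_Diff_disjoint:
  "(P - E) \<inter> (Q - F) = {} \<Longrightarrow> E \<subseteq> V \<Longrightarrow> F \<subseteq> V \<Longrightarrow> P \<inter> Q \<subseteq> V"
  by blast

lemma based_imp_path_model:
  assumes J: "loopless_graph J" and b: "based J G"
  shows "\<exists>\<phi> pv pe. path_model G J \<phi> pv pe \<and> matchable G (verts G - model_verts J \<phi> pv)"
proof -
  obtain H where H: "conformal H G" "bisubdivision H J" using b by (auto simp: based_def)
  from H(2) obtain \<phi> pv pe where inj: "inj_on \<phi> (verts J)"
    and p: "\<forall>e\<in>edges J. is_path H (pv e) (pe e) \<and> {hd (pv e), last (pv e)} = \<phi> ` ends J e \<and>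
      even (length (internal_verts (pv e))) \<and> set (internal_verts (pv e)) \<inter> \<phi> ` verts J = {}"
    and d: "\<forall>e\<in>edges J. \<forall>f\<in>edges J. e \<noteq> f \<longrightarrow>
      set (internal_verts (pv e)) \<inter> set (internal_verts (pv f)) = {} \<and> set (pe e) \<inter> set (pe f) = {}"
    and VH: "verts H = \<phi> ` verts J \<union> (\<Union>e\<in>edges J. set (internal_verts (pv e)))"
    unfolding bisubdivision_def by (elim exE conjE)
  have sub: "subgraph H G" using H by (simp add: conformal_def)
  have i: "set (internal_verts (pv e)) = set (pv e) - \<phi> ` ends J e"
    "even (length (pv e))" "\<phi> ` ends J e \<subseteq> \<phi> ` verts J" "\<phi> ` ends J e \<subseteq> set (pv e)"
    "is_path G (pv e) (pe e)" if e: "e \<in> edges J" for e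
  proof -
    have pe: "is_path H (pv e) (pe e)" "{hd (pv e), last (pv e)} = \<phi> ` ends J e"
      "even (length (internal_verts (pv e)))" using p e by auto
    have ne: "hd (pv e) \<noteq> last (pv e)" by (rule inj_on_ends_neq[OF J inj e pe(2)])
    show "set (internal_verts (pv e)) = set (pv e) - \<phi> ` ends J e"
      using internal_verts_path(1)[OF pe(1) ne] pe(2) by simp
    show "even (length (pv e))" using internal_verts_path(2)[OF pe(1) ne] pe(3) by simp
    show "\<phi> ` ends J e \<subseteq> \<phi> ` verts J" using J e by (auto simp: loopless_graph_def)
    show "\<phi> ` ends J e \<subseteq> set (pv e)" using is_path_not_Nil[OF pe(1)] pe(2)[symmetric] by simp
    show "is_path G (pv e) (pe e)"
    proof (rule is_path_mono[OF pe(1)])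
      show "ends G g = ends H g" if "g \<in> set (pe e)" for g
        using that is_path_edges[OF pe(1)] sub by (auto simp: subgraph_def)
    qed (use is_path_verts[OF pe(1)] is_path_edges[OF pe(1)] sub in \<open>auto simp: subgraph_def\<close>)
  qed
  have disj: "set (internal_verts (pv e)) \<inter> \<phi> ` verts J = {}" if "e \<in> edges J" for e
    using p that by blast
  have V: "verts H = model_verts J \<phi> pv"
  proof -
    have "\<phi> ` verts J \<union> (\<Union>e\<in>edges J. set (internal_verts (pv e))) =
        \<phi> ` verts J \<union> (\<Union>e\<in>edges J. set (pv e) - \<phi> ` ends J e)"
      using i(1) by simp
    also have "\<dots> = \<phi> ` verts J \<union> (\<Union>e\<in>edges J. set (pv e))"
      using i(3) by fast
    finally show ?thesis unfolding VH model_verts_def .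
  qed
  have "path_model G J \<phi> pv pe"
    unfolding path_model_def
  proof (intro conjI ballI impI)
    show "\<phi> ` verts J \<subseteq> verts G" using sub unfolding subgraph_def VH by blast
    show "set (pv e) \<inter> \<phi> ` verts J \<subseteq> \<phi> ` ends J e" if "e \<in> edges J" for e
      using disj[OF that] unfolding i(1)[OF that] by auto
    show "set (pv e) \<inter> set (pv f) \<subseteq> \<phi> ` verts J" if "e \<in> edges J" "f \<in> edges J" "e \<noteq> f" for e f
    proof -
      have "set (internal_verts (pv e)) \<inter> set (internal_verts (pv f)) = {}" using d that by simp
      then show ?thesis
        unfolding i(1)[OF that(1)] i(1)[OF that(2)]
        by (rule Int_subset_if_Diff_disjoint) (rule i(3), fact)+
    qed
    show "set (pe e) \<inter> set (pe f) = {}" if "e \<in> edges J" "f \<in> edges J" "e \<noteq> f" for e f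
      using d that by simp
    show "{hd (pv e), last (pv e)} = \<phi> ` ends J e" if "e \<in> edges J" for e
      using p that by simp
  qed (simp_all add: inj i)
  moreover have "matchable G (verts G - verts H)"
    using H by (simp add: conformal_def perfect_matching_delete_iff)
  ultimately show ?thesis unfolding V by blast
qed

text \<open>The conformal subgraph is the union of the paths and the branch vertices, with no
  further edges, since a bisubdivision has to account for every edge.\<close>

lemma path_model_imp_based:
  assumes G: "loopless_graph G" and J: "loopless_graph J"
    and m: "path_model G J \<phi> pv pe" and pm: "matchable G (verts G - model_verts J \<phi> pv)"
  shows "based J G"
proof -
  define H where "H = \<lparr>verts = model_verts J \<phi> pv, edges = (\<Union>e\<in>edges J. set (pe e)), ends = ends G\<rparr>"
  have inj: "inj_on \<phi> (verts J)" and VJ: "\<phi> ` verts J \<subseteq> verts G" using m by (auto simp: path_model_def)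
  have p: "is_path G (pv e) (pe e)" "{hd (pv e), last (pv e)} = \<phi> ` ends J e"
    "even (length (pv e))" "set (pv e) \<inter> \<phi> ` verts J \<subseteq> \<phi> ` ends J e" if "e \<in> edges J" for e
    using m that by (auto simp: path_model_def)
  have d: "set (pv e) \<inter> set (pv f) \<subseteq> \<phi> ` verts J" "set (pe e) \<inter> set (pe f) = {}"
    if "e \<in> edges J" "f \<in> edges J" "e \<noteq> f" for e f
    using m that unfolding path_model_def by blast+
  have VH: "verts H \<subseteq> verts G"
    using VJ is_path_verts[OF p(1)] by (auto simp: H_def model_verts_def)
  have EH: "edges H \<subseteq> edges G" using is_path_edges[OF p(1)] by (auto simp: H_def)
  have ends: "ends G g \<subseteq> verts H" if "g \<in> edges H" for g
    using that is_path_ends[OF p(1)] unfolding H_def model_verts_def by fastforce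
  have "finite (verts H)" "finite (edges H)"
    using G VH EH finite_subset unfolding loopless_graph_def by metis+
  moreover have "\<forall>g\<in>edges H. ends H g = ends G g" by (simp add: H_def)
  ultimately have "subgraph H G"
    using G VH EH ends unfolding subgraph_def loopless_graph_def by (metis subsetD)
  then have "conformal H G" using pm by (simp add: conformal_def perfect_matching_delete_iff H_def)
  moreover have "bisubdivision H J"
    unfolding bisubdivision_def
  proof (intro exI conjI)
    have i: "set (internal_verts (pv e)) = set (pv e) - \<phi> ` ends J e"
      "even (length (internal_verts (pv e)))" "\<phi> ` ends J e \<subseteq> \<phi> ` verts J"
      "is_path H (pv e) (pe e)" if e: "e \<in> edges J" for e
    proof -
      have ne: "hd (pv e) \<noteq> last (pv e)" by (rule inj_on_ends_neq[OF J inj e p(2)[OF e]])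
      show "set (internal_verts (pv e)) = set (pv e) - \<phi> ` ends J e"
        using internal_verts_path(1)[OF p(1)[OF e] ne] p(2)[OF e] by simp
      show "even (length (internal_verts (pv e)))"
        using internal_verts_path(2)[OF p(1)[OF e] ne] p(3)[OF e] by simp
      show "\<phi> ` ends J e \<subseteq> \<phi> ` verts J" using J e by (auto simp: loopless_graph_def)
      show "is_path H (pv e) (pe e)"
        by (rule is_path_mono[OF p(1)[OF e]]) (use e in \<open>auto simp: H_def model_verts_def\<close>)
    qed
    show "inj_on \<phi> (verts J)" by (rule inj)
    show "\<forall>e\<in>edges J. is_path H (pv e) (pe e) \<and> {hd (pv e), last (pv e)} = \<phi> ` ends J e \<and>
        even (length (internal_verts (pv e))) \<and> set (internal_verts (pv e)) \<inter> \<phi> ` verts J = {}"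
    proof (intro ballI conjI)
      fix e assume e: "e \<in> edges J"
      show "set (internal_verts (pv e)) \<inter> \<phi> ` verts J = {}"
        using p(4)[OF e] unfolding i(1)[OF e] by auto
    qed (simp_all add: i p(2))
    show "\<forall>e\<in>edges J. \<forall>f\<in>edges J. e \<noteq> f \<longrightarrow>
        set (internal_verts (pv e)) \<inter> set (internal_verts (pv f)) = {} \<and> set (pe e) \<inter> set (pe f) = {}"
    proof (intro ballI impI conjI)
      fix e f assume ef: "e \<in> edges J" "f \<in> edges J" "e \<noteq> f"
      show "set (internal_verts (pv e)) \<inter> set (internal_verts (pv f)) = {}"
        using d(1)[OF ef] p(4)[OF ef(1)] unfolding i(1)[OF ef(1)] i(1)[OF ef(2)] by auto
      show "set (pe e) \<inter> set (pe f) = {}" by (rule d(2)[OF ef])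
    qed
    show "verts H = \<phi> ` verts J \<union> (\<Union>e\<in>edges J. set (internal_verts (pv e)))"
    proof -
      have "\<phi> ` verts J \<union> (\<Union>e\<in>edges J. set (internal_verts (pv e))) =
          \<phi> ` verts J \<union> (\<Union>e\<in>edges J. set (pv e) - \<phi> ` ends J e)"
        using i(1) by simp
      also have "\<dots> = \<phi> ` verts J \<union> (\<Union>e\<in>edges J. set (pv e))"
        using i(3) by fast
      finally show ?thesis by (simp add: H_def model_verts_def)
    qed
    show "edges H = (\<Union>e\<in>edges J. set (pe e))" by (simp add: H_def)
  qed
  ultimately show ?thesis unfolding based_def by blast
qed

section \<open>Undoing the contraction\<close>

text \<open>All that undoing the contraction of \<open>S\<close> uses of the barrier: components and
  their parities do not occur below. The assumption \<open>base\<close> covers a contracted branch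
  vertex to which no edge of \<open>J\<close> is attached.\<close>

locale contracted_side =
  fixes G :: "('v, 'e) multigraph" and C S B :: "'v set"
  assumes loopless: "loopless_graph G"
    and verts_eq: "verts G = C \<union> S" and disjoint: "C \<inter> S = {}" and B_sub: "B \<subseteq> S"
    and cut: "\<And>e a b. e \<in> edges G \<Longrightarrow> ends G e = {a, b} \<Longrightarrow> a \<in> C \<Longrightarrow> b \<in> S \<Longrightarrow>
      b \<in> B \<and> matchable G (S - {b})"
    and sparse: "\<And>T. T \<subseteq> B \<Longrightarrow> matchable G (S - T) \<Longrightarrow> card T \<le> 1"
    and base: "S \<noteq> {} \<Longrightarrow> \<exists>b\<in>S. matchable G (S - {b})"
begin

lemma finite_S: "finite S"
  using loopless by (simp add: loopless_graph_def verts_eq)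

lemma shrink_map_eq_Some: "shrink_map S u = Some v \<longleftrightarrow> u = v \<and> v \<notin> S"
  by (auto simp: shrink_map_def)

lemma verts_shrink: "verts (shrink G S) = Some ` C \<union> (if S = {} then {} else {None})"
  using disjoint by (auto simp: shrink_def verts_eq shrink_map_def image_iff)

section \<open>Edges, paths and matchings of the contraction seen in the original graph\<close>

lemma ends_shrinkE:
  assumes "e \<in> edges (shrink G S)"
  obtains a b where "e \<in> edges G" "ends G e = {a, b}" "a \<in> C" "a \<noteq> b" "b \<in> C \<union> S"
    "ends (shrink G S) e = {Some a, shrink_map S b}"
proof -
  have e: "e \<in> edges G" "\<not> ends G e \<subseteq> S" using assms by (auto simp: shrink_def)
  then obtain a where a: "a \<in> ends G e" "a \<notin> S" by blast
  obtain b where b: "ends G e = {a, b}" "b \<noteq> a" using loopless_other_end[OF loopless e(1) a(1)] .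
  have "{a, b} \<subseteq> C \<union> S" using loopless e(1) b(1) verts_eq by (auto simp: loopless_graph_def)
  then show thesis using that[of a b] e a b by (auto simp: shrink_def shrink_map_def)
qed

lemma loopless_shrink: "loopless_graph (shrink G S)"
  unfolding loopless_graph_def
proof (intro conjI ballI)
  have fin: "finite (verts G)" "finite (edges G)" using loopless by (auto simp: loopless_graph_def)
  then show "finite (verts (shrink G S))" "finite (edges (shrink G S))" by (auto simp: shrink_def)
  fix e assume "e \<in> edges (shrink G S)"
  from ends_shrinkE[OF this] obtain a b where *: "a \<in> C" "a \<noteq> b" "b \<in> C \<union> S"
    "ends (shrink G S) e = {Some a, shrink_map S b}" by metis
  then show "ends (shrink G S) e \<subseteq> verts (shrink G S)"
    by (auto simp: verts_shrink shrink_map_def)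
  have "Some a \<noteq> shrink_map S b" using * by (simp add: shrink_map_def)
  then show "card (ends (shrink G S) e) = 2" using * by simp
qed

lemma end_Some_Some:
  assumes "e \<in> edges (shrink G S)" "ends (shrink G S) e = {Some a, Some b}"
  shows "e \<in> edges G \<and> ends G e = {a, b} \<and> a \<in> C \<and> b \<in> C"
  using ends_shrinkE[OF assms(1)] assms(2)
  by (smt (verit) Un_iff disjoint doubleton_eq_iff insert_commute shrink_map_eq_Some option.inject)

lemma end_None_Some:
  assumes "e \<in> edges (shrink G S)" "ends (shrink G S) e = {None, Some a}"
  obtains b where "e \<in> edges G" "ends G e = {a, b}" "a \<in> C" "b \<in> B" "matchable G (S - {b})"
proof -
  obtain a' b where *: "e \<in> edges G" "ends G e = {a', b}" "a' \<in> C" "b \<in> C \<union> S"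
    "ends (shrink G S) e = {Some a', shrink_map S b}"
    using ends_shrinkE[OF assms(1)] by metis
  then have "a' = a" "shrink_map S b = None" using assms(2) by (auto simp: doubleton_eq_iff)
  then have "b \<in> S" by (auto simp: shrink_map_def split: if_splits)
  then show thesis using that cut[OF *(1,2,3)] * \<open>a' = a\<close> by blast
qed

lemma is_path_lift:
  assumes "is_path (shrink G S) (map Some vs) es"
  shows "is_path G vs es \<and> set vs \<subseteq> C"
  using assms
proof (induction vs arbitrary: es)
  case (Cons u vs)
  show ?case
  proof (cases vs)
    case Nil
    then show ?thesis using Cons.prems by (auto simp: verts_shrink verts_eq split: if_splits)
  next
    case (Cons v ws)
    then obtain e es' where e: "es = e # es'" "e \<in> edges (shrink G S)"
      "ends (shrink G S) e = {Some u, Some v}" "u \<notin> set vs" "is_path (shrink G S) (map Some vs) es'"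
      using Cons.prems by (auto simp: is_path_Cons_Cons)
    then show ?thesis using Cons.IH[OF e(5)] end_Some_Some[OF e(2,3)] Cons
      by (auto simp: is_path_Cons_Cons verts_eq)
  qed
qed simp

text \<open>Edges of the contraction that avoid \<open>None\<close> have both ends in
  \<open>C\<close>, and there shrinking only renames vertices.\<close>

lemma matchable_lift:
  assumes "matchable (shrink G S) (Some ` Y)" "Y \<subseteq> C"
  shows "matchable G Y"
proof -
  obtain M where M: "covers_exactly (shrink G S) M (Some ` Y)" using assms by (auto simp: matchable_def)
  have e: "e \<in> edges G \<and> ends (shrink G S) e = Some ` ends G e \<and> ends G e \<subseteq> Y" if "e \<in> M" for e
  proof -
    have e: "e \<in> edges (shrink G S)" "ends (shrink G S) e \<subseteq> Some ` Y"
      using M that by (auto simp: covers_exactly_def)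
    from ends_shrinkE[OF e(1)] obtain a b where *: "e \<in> edges G" "ends G e = {a, b}"
      "ends (shrink G S) e = {Some a, shrink_map S b}" by metis
    then obtain b' where b': "shrink_map S b = Some b'" "b' \<in> Y" "a \<in> Y" using e(2) by auto
    then have "b = b'" by (simp add: shrink_map_eq_Some)
    then show ?thesis using * b' by simp
  qed
  have "covers_exactly G M Y"
    unfolding covers_exactly_def
  proof (intro conjI ballI)
    show "\<exists>!g. g \<in> M \<and> v \<in> ends G g" if "v \<in> Y" for v
    proof -
      have "\<exists>!g. g \<in> M \<and> Some v \<in> ends (shrink G S) g" using M that by (simp add: covers_exactly_def)
      moreover have "Some v \<in> ends (shrink G S) g \<longleftrightarrow> v \<in> ends G g" if "g \<in> M" for g
        using e[OF that] by auto
      ultimately show ?thesis by metis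
    qed
  qed (use e in auto)
  then show ?thesis by (auto simp: matchable_def)
qed

text \<open>\<open>(vs', es')\<close> is obtained from a path \<open>(vs, es)\<close> of the contraction by replacing the contracted
  vertex, if present, by a path with vertex set \<open>Z\<close>; \<open>x\<close> is the new name of \<open>None\<close>.\<close>

definition replaces ::
    "'v \<Rightarrow> 'v set \<Rightarrow> 'v option list \<Rightarrow> 'e list \<Rightarrow> 'v list \<Rightarrow> 'e list \<Rightarrow> bool" where
  "replaces x Z vs es vs' es' \<longleftrightarrow> is_path G vs' es' \<and>
     {hd vs', last vs'} = case_option x id ` {hd vs, last vs} \<and>
     even (length vs') = even (length vs) \<and> set vs' = Some -` set vs \<union> Z \<and>
     set es' \<subseteq> set es \<union> {g \<in> edges G. ends G g \<subseteq> Z}"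

lemma no_None_map_Some: "None \<notin> set vs \<Longrightarrow> \<exists>ws. vs = map Some ws"
  by (metis ex_map_conv not_None_eq)

lemma replaces_no_None:
  assumes "is_path (shrink G S) vs es" "None \<notin> set vs"
  shows "\<exists>vs' es'. replaces x {} vs es vs' es'"
proof -
  obtain ws where ws: "vs = map Some ws" using no_None_map_Some[OF assms(2)] by blast
  then have "ws \<noteq> []" using is_path_not_Nil[OF assms(1)] by simp
  then have "replaces x {} vs es ws es"
    using is_path_lift[of ws es] assms(1) ws by (auto simp: replaces_def hd_map last_map)
  then show ?thesis by blast
qed

lemma is_path_from_None:
  assumes "is_path (shrink G S) (None # map Some ys) es" "ys \<noteq> []"
  obtains b g es' where "es = g # es'" "is_path G ys es'" "set ys \<subseteq> C" "g \<in> edges G"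
    "ends G g = {b, hd ys}" "b \<in> B" "matchable G (S - {b})"
proof -
  obtain y ys' where y: "ys = y # ys'" using assms(2) by (cases ys) auto
  from assms(1) obtain g es' where g: "es = g # es'" "g \<in> edges (shrink G S)"
    "ends (shrink G S) g = {None, Some y}" "is_path (shrink G S) (map Some ys) es'"
    by (auto simp: is_path_Cons_Cons y)
  from end_None_Some[OF g(2,3)] obtain b where
    b: "g \<in> edges G" "ends G g = {y, b}" "b \<in> B" "matchable G (S - {b})" by metis
  then have "ends G g = {b, hd ys}" using y by auto
  then show thesis using that[OF g(1) _ _ b(1) _ b(3,4)] is_path_lift[OF g(4)] by simp
qed

lemma path_vertex_set_induced:
  assumes "is_path G R RE"
  shows "set RE \<subseteq> {g \<in> edges G. ends G g \<subseteq> set R}"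
  using is_path_edges[OF assms] is_path_ends[OF assms] by auto

text \<open>The first edge of the path is a cut edge and fixes \<open>b\<close>; it becomes the link
  between \<open>R\<close> and the remainder. The leg \<open>R\<close> is quantified after
  \<open>b\<close> because the legs of all edges at the branch vertex have to be chosen together,
  once all their ends in \<open>B\<close> are known.\<close>

lemma replaces_hd_None:
  assumes p: "is_path (shrink G S) vs es" and h: "hd vs = None" "last vs \<noteq> None"
  shows "\<exists>b. b \<in> B \<and> matchable G (S - {b}) \<and>
    (\<forall>R RE. is_path G R RE \<and> last R = b \<and> set R \<subseteq> S \<and> odd (length R) \<longrightarrow>
      (\<exists>vs' es'. replaces (hd R) (set R) vs es vs' es'))"
proof -
  obtain vs0 where vs0: "vs = None # vs0" using h is_path_not_Nil[OF p] by (cases vs) auto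
  have "None \<notin> set vs0" using is_path_distinct[OF p] vs0 by simp
  then obtain ys where ys: "vs = None # map Some ys" using no_None_map_Some vs0 by blast
  have ne: "ys \<noteq> []" using h ys by auto
  obtain b g es' where g: "es = g # es'" "is_path G ys es'" "set ys \<subseteq> C" "g \<in> edges G"
    "ends G g = {b, hd ys}" "b \<in> B" "matchable G (S - {b})"
    using is_path_from_None[of ys es] p ys ne by metis
  have "replaces (hd R) (set R) vs es (R @ ys) (RE @ g # es')"
    if R: "is_path G R RE" "last R = b" "set R \<subseteq> S" "odd (length R)" for R RE
    unfolding replaces_def
  proof (intro conjI)
    have "set R \<inter> set ys = {}" using R(3) g(3) disjoint by blast
    then show "is_path G (R @ ys) (RE @ g # es')" using is_path_append[OF R(1) g(2)] g R by simp
    show "{hd (R @ ys), last (R @ ys)} = case_option (hd R) id ` {hd vs, last vs}"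
      using ys ne is_path_not_Nil[OF R(1)] by (simp add: last_map)
    show "even (length (R @ ys)) = even (length vs)" using R(4) ys by simp
    show "set (R @ ys) = Some -` set vs \<union> set R" using ys by auto
    show "set (RE @ g # es') \<subseteq> set es \<union> {g \<in> edges G. ends G g \<subseteq> set R}"
      using path_vertex_set_induced[OF R(1)] g(1) by auto
  qed
  then show ?thesis using g(6,7) by blast
qed

lemma replaces_end_None:
  assumes p: "is_path (shrink G S) vs es" and h: "None \<in> {hd vs, last vs}" "hd vs \<noteq> last vs"
  shows "\<exists>b. b \<in> B \<and> matchable G (S - {b}) \<and>
    (\<forall>R RE. is_path G R RE \<and> last R = b \<and> set R \<subseteq> S \<and> odd (length R) \<longrightarrow>
      (\<exists>vs' es'. replaces (hd R) (set R) vs es vs' es'))"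
proof (cases "hd vs = None")
  case True
  then show ?thesis using replaces_hd_None[OF p] h(2) by metis
next
  case False
  have "replaces x Z vs es vs' es'" if "replaces x Z (rev vs) (rev es) vs' es'" for x Z vs' es'
    using that is_path_not_Nil[OF p] by (simp add: replaces_def hd_rev last_rev insert_commute)
  moreover have "hd (rev vs) = None" "last (rev vs) \<noteq> None"
    using False h is_path_not_Nil[OF p] by (auto simp: hd_rev last_rev)
  ultimately show ?thesis using replaces_hd_None[OF is_path_rev[OF p]] by meson
qed

text \<open>The two edges of the path at \<open>None\<close> are cut edges with ends
  \<open>b1\<close> and \<open>b2\<close> in \<open>B\<close>, possibly equal, and any odd path
  between these can be spliced in. The name \<open>x\<close> is arbitrary since neither end of the
  path is \<open>None\<close>.\<close>

lemma replaces_internal_None: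
  assumes p: "is_path (shrink G S) vs es" and h: "None \<in> set vs" "hd vs \<noteq> None" "last vs \<noteq> None"
  shows "\<exists>b1 b2. b1 \<in> B \<and> b2 \<in> B \<and> matchable G (S - {b1}) \<and> matchable G (S - {b2}) \<and>
    (\<forall>R RE. is_path G R RE \<and> hd R = b1 \<and> last R = b2 \<and> set R \<subseteq> S \<and> odd (length R) \<longrightarrow>
      (\<exists>vs' es'. replaces x (set R) vs es vs' es'))"
proof -
  obtain vs1 vs2 where v: "vs = vs1 @ None # vs2" using h(1) by (meson split_list)
  have "None \<notin> set vs1" "None \<notin> set vs2" using is_path_distinct[OF p] v by auto
  then obtain xs ys where xy: "vs1 = map Some xs" "vs2 = map Some ys" using no_None_map_Some by metis
  have ne: "xs \<noteq> []" "ys \<noteq> []" using h v xy by auto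
  have p': "is_path (shrink G S) (map Some xs @ None # map Some ys) es" using p v xy by simp
  from is_path_split[OF p'] ne obtain es1 g1 es' where
    s: "es = es1 @ g1 # es'" "is_path (shrink G S) (map Some xs) es1"
    "is_path (shrink G S) (None # map Some ys) es'" "g1 \<in> edges (shrink G S)"
    "ends (shrink G S) g1 = {None, Some (last xs)}"
    by (auto simp: last_map insert_commute)
  obtain b1 where b1: "g1 \<in> edges G" "ends G g1 = {last xs, b1}" "b1 \<in> B" "matchable G (S - {b1})"
    using end_None_Some[OF s(4,5)] by metis
  obtain b2 g2 es2 where g: "es' = g2 # es2" "is_path G ys es2" "set ys \<subseteq> C" "g2 \<in> edges G"
    "ends G g2 = {b2, hd ys}" "b2 \<in> B" "matchable G (S - {b2})"
    using is_path_from_None[OF s(3) ne(2)] by metis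
  have l: "is_path G xs es1" "set xs \<subseteq> C" using is_path_lift[OF s(2)] by auto
  have dxy: "set xs \<inter> set ys = {}" using is_path_distinct[OF p'] by auto
  have "replaces x (set R) vs es (xs @ R @ ys) (es1 @ g1 # RE @ g2 # es2)"
    if R: "is_path G R RE" "hd R = b1" "last R = b2" "set R \<subseteq> S" "odd (length R)" for R RE
    unfolding replaces_def
  proof (intro conjI)
    have dR: "set R \<inter> set ys = {}" "set xs \<inter> set R = {}" using R(4) g(3) l(2) disjoint by blast+
    have Rne: "R \<noteq> []" using is_path_not_Nil[OF R(1)] .
    have "is_path G (R @ ys) (RE @ g2 # es2)" using is_path_append[OF R(1) g(2) dR(1)] g R by simp
    then show "is_path G (xs @ R @ ys) (es1 @ g1 # RE @ g2 # es2)"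
    proof (rule is_path_append[OF l(1)])
      show "set xs \<inter> set (R @ ys) = {}" using dR dxy by (simp add: Int_Un_distrib)
      show "ends G g1 = {last xs, hd (R @ ys)}" using b1(2) R(2) Rne by simp
    qed (rule b1)
    show "{hd (xs @ R @ ys), last (xs @ R @ ys)} = case_option x id ` {hd vs, last vs}"
      using v xy ne by (simp add: last_map hd_map)
    show "even (length (xs @ R @ ys)) = even (length vs)" using R(5) v xy by simp
    show "set (xs @ R @ ys) = Some -` set vs \<union> set R" using v xy by auto
    show "set (es1 @ g1 # RE @ g2 # es2) \<subseteq> set es \<union> {g \<in> edges G. ends G g \<subseteq> set R}"
      using path_vertex_set_induced[OF R(1)] g(1) s(1) by auto
  qed
  then show ?thesis using b1(3,4) g(6,7) by blast
qed

text \<open>\<open>Z e\<close> is the part of \<open>S\<close> inserted into the path of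
  \<open>e\<close>. \<open>X\<close> allows one statement for both situations: if
  \<open>None\<close> is a branch vertex, inserted parts may share its substitute \<open>x\<close>;
  otherwise they must be disjoint.\<close>

lemma path_model_transfer:
  fixes Z :: "'f \<Rightarrow> 'v set" and J :: "('w, 'f) multigraph"
  defines "X \<equiv> \<lambda>\<phi> x. if None \<in> \<phi> ` verts J then {x} else {}"
  assumes J: "loopless_graph J" and m: "path_model (shrink G S) J \<phi> pv pe"
    and x: "X \<phi> x \<subseteq> S"
    and r: "\<forall>e\<in>edges J. replaces x (Z e) (pv e) (pe e) (pv' e) (pe' e)"
    and ZS: "\<forall>e\<in>edges J. Z e \<subseteq> S"
    and Zn: "\<forall>e\<in>edges J. None \<notin> set (pv e) \<longrightarrow> Z e = {}"
    and Zd: "\<forall>e\<in>edges J. \<forall>f\<in>edges J. e \<noteq> f \<longrightarrow> Z e \<inter> Z f \<subseteq> X \<phi> x"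
  shows "path_model G J (case_option x id \<circ> \<phi>) pv' pe'"
    and "model_verts J (case_option x id \<circ> \<phi>) pv' =
      Some -` model_verts J \<phi> pv \<union> (X \<phi> x \<union> (\<Union>e\<in>edges J. Z e))"
proof -
  let ?\<sigma> = "case_option x id" and ?U = "\<phi> ` verts J" and ?X = "X \<phi> x"
  have inj: "inj_on \<phi> (verts J)" and U: "?U \<subseteq> verts (shrink G S)"
    using m by (auto simp: path_model_def)
  have p: "is_path (shrink G S) (pv e) (pe e)" "{hd (pv e), last (pv e)} = \<phi> ` ends J e"
    "even (length (pv e))" "set (pv e) \<inter> ?U \<subseteq> \<phi> ` ends J e" if "e \<in> edges J" for e
    using m that by (auto simp: path_model_def)
  have d: "set (pv e) \<inter> set (pv f) \<subseteq> ?U" "set (pe e) \<inter> set (pe f) = {}"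
    if "e \<in> edges J" "f \<in> edges J" "e \<noteq> f" for e f
    using m that unfolding path_model_def by blast+
  have rp: "is_path G (pv' e) (pe' e)" "{hd (pv' e), last (pv' e)} = ?\<sigma> ` \<phi> ` ends J e"
    "even (length (pv' e))" "set (pv' e) = Some -` set (pv e) \<union> Z e"
    "set (pe' e) \<subseteq> set (pe e) \<union> {g \<in> edges G. ends G g \<subseteq> Z e}" if "e \<in> edges J" for e
    using bspec[OF r that] p(2,3)[OF that] by (auto simp: replaces_def)
  have notS: "v \<in> C \<and> v \<notin> S" if "Some v \<in> verts (shrink G S)" for v
    using that disjoint by (auto simp: verts_shrink split: if_splits)
  have U': "(?\<sigma> \<circ> \<phi>) ` verts J = Some -` ?U \<union> ?X"
  proof -
    have "?\<sigma> ` A = Some -` A \<union> (if None \<in> A then {x} else {})" for A :: "'v option set"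
      by (force simp: image_iff split: option.splits)
    then show ?thesis unfolding X_def image_comp[symmetric] by blast
  qed
  have pvU: "Some v \<in> verts (shrink G S)" if "e \<in> edges J" "Some v \<in> set (pv e)" for e v
    using is_path_verts[OF p(1)[OF that(1)]] that(2) by blast
  show "path_model G J (?\<sigma> \<circ> \<phi>) pv' pe'"
    unfolding path_model_def
  proof (intro conjI ballI impI)
    have "inj_on ?\<sigma> ?U"
    proof (rule inj_onI)
      fix u v assume uv: "u \<in> ?U" "v \<in> ?U" "?\<sigma> u = ?\<sigma> v"
      have *: "w \<noteq> x" if "None \<in> ?U" "Some w \<in> ?U" for w
        using x that U notS[of w] by (auto simp: X_def)
      show "u = v" using uv * by (cases u; cases v) auto
    qed
    then show "inj_on (?\<sigma> \<circ> \<phi>) (verts J)" using inj by (rule comp_inj_on[rotated])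
    show "(?\<sigma> \<circ> \<phi>) ` verts J \<subseteq> verts G"
      unfolding U' using U notS x verts_eq by blast
    fix e assume e: "e \<in> edges J"
    show "is_path G (pv' e) (pe' e)" "even (length (pv' e))" by (rule rp[OF e])+
    show "{hd (pv' e), last (pv' e)} = (?\<sigma> \<circ> \<phi>) ` ends J e"
      using rp(2)[OF e] by (simp add: image_comp)
    show "set (pv' e) \<inter> (?\<sigma> \<circ> \<phi>) ` verts J \<subseteq> (?\<sigma> \<circ> \<phi>) ` ends J e"
    proof
      fix v assume "v \<in> set (pv' e) \<inter> (?\<sigma> \<circ> \<phi>) ` verts J"
      then have v: "v \<in> Some -` set (pv e) \<union> Z e" "v \<in> Some -` ?U \<union> ?X"
        unfolding U' rp(4)[OF e] by auto
      show "v \<in> (?\<sigma> \<circ> \<phi>) ` ends J e"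
      proof (cases "v \<in> S")
        case True
        \<comment> \<open>Vertices surviving from the contraction lie in \<open>C\<close>, so a
          branch vertex in \<open>S\<close> can only be \<open>x\<close>. It lies on the new path
          only if \<open>None\<close> lay on the old one, and then \<open>None\<close> was an end of
          \<open>e\<close>.\<close>
        have "v \<notin> Some -` set (pv e)" "v \<notin> Some -` ?U"
          using True notS[of v] pvU[OF e, of v] U by auto
        then have "v \<in> Z e" "v \<in> ?X" using v by auto
        then have "v = x" "None \<in> ?U" "None \<in> set (pv e)" using bspec[OF Zn e]
          by (auto simp: X_def split: if_splits)
        then have "None \<in> \<phi> ` ends J e" using p(4)[OF e] by blast
        then have "?\<sigma> None \<in> ?\<sigma> ` \<phi> ` ends J e" by (rule imageI)
        then show ?thesis using \<open>v = x\<close> by (simp add: image_comp)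
      next
        case False
        then have "Some v \<in> set (pv e)" "Some v \<in> ?U" using v bspec[OF ZS e] x by auto
        then have "Some v \<in> \<phi> ` ends J e" using p(4)[OF e] by blast
        then have "?\<sigma> (Some v) \<in> ?\<sigma> ` \<phi> ` ends J e" by (rule imageI)
        then show ?thesis by (simp add: image_comp)
      qed
    qed
    fix f assume f: "f \<in> edges J" "e \<noteq> f"
    have Zef: "Z e \<inter> Z f \<subseteq> ?X" using Zd e f by simp
    show "set (pv' e) \<inter> set (pv' f) \<subseteq> (?\<sigma> \<circ> \<phi>) ` verts J"
    proof
      fix v assume "v \<in> set (pv' e) \<inter> set (pv' f)"
      then have v: "v \<in> Some -` set (pv e) \<union> Z e" "v \<in> Some -` set (pv f) \<union> Z f"
        unfolding rp(4)[OF e] rp(4)[OF f(1)] by auto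
      have "v \<in> Some -` ?U \<union> ?X"
      proof (cases "v \<in> S")
        case True
        then have "v \<in> Z e \<inter> Z f" using v notS[of v] pvU[OF e, of v] pvU[OF f(1), of v] by auto
        then show ?thesis using Zef by blast
      next
        case False
        then have "Some v \<in> set (pv e) \<inter> set (pv f)" using v bspec[OF ZS e] bspec[OF ZS f(1)] by auto
        then show ?thesis using d(1)[OF e f] by blast
      qed
      then show "v \<in> (?\<sigma> \<circ> \<phi>) ` verts J" unfolding U' .
    qed
    show "set (pe' e) \<inter> set (pe' f) = {}"
    proof (rule ccontr)
      assume "set (pe' e) \<inter> set (pe' f) \<noteq> {}"
      then obtain g where "g \<in> set (pe' e)" "g \<in> set (pe' f)" by blast
      then have g: "g \<in> set (pe e) \<or> ends G g \<subseteq> Z e" "g \<in> set (pe f) \<or> ends G g \<subseteq> Z f" "g \<in> edges G"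
        using rp(5)[OF e] rp(5)[OF f(1)] is_path_edges[OF rp(1)[OF e]] by auto
      \<comment> \<open>Edges of the contraction have an end outside \<open>S\<close>, inserted
        edges do not. A common edge would thus be inserted in both paths and have all its ends in
        \<open>{x}\<close>, which looplessness forbids.\<close>
      have nS: "\<not> ends G g \<subseteq> S" if "g \<in> set (pe h)" "h \<in> edges J" for h
        using is_path_edges[OF p(1)[OF that(2)]] that(1) by (auto simp: shrink_def)
      have "ends G g \<subseteq> Z e" "ends G g \<subseteq> Z f"
        using g(1,2) nS[OF _ e] nS[OF _ f(1)] bspec[OF ZS e] bspec[OF ZS f(1)] d(2)[OF e f] by blast+
      then have "ends G g \<subseteq> {x}" using Zef by (auto simp: X_def split: if_splits)
      then have "card (ends G g) \<le> 1" using card_mono[of "{x}" "ends G g"] by simp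
      then show False using loopless g(3) by (auto simp: loopless_graph_def)
    qed
  qed
  show "model_verts J (?\<sigma> \<circ> \<phi>) pv' = Some -` model_verts J \<phi> pv \<union> (?X \<union> (\<Union>e\<in>edges J. Z e))"
    unfolding model_verts_def U' using rp(4) by auto
qed

section \<open>Matching the vertices outside the subgraph\<close>

lemma matchable_if_None_used:
  assumes "matchable (shrink G S) (verts (shrink G S) - V)" "None \<in> V" "Z \<subseteq> S" "matchable G (S - Z)"
  shows "matchable G (verts G - (Some -` V - S \<union> Z))"
proof -
  have "verts (shrink G S) - V = Some ` (C - Some -` V)"
    using assms(2) by (auto simp: verts_shrink)
  then have "matchable G (C - Some -` V)" using matchable_lift assms(1) by simp
  then have "matchable G ((C - Some -` V) \<union> (S - Z))"
    using assms(4) disjoint by (intro matchable_Un) auto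
  moreover have "(C - Some -` V) \<union> (S - Z) = verts G - (Some -` V - S \<union> Z)"
    using assms(3) disjoint verts_eq by auto
  ultimately show ?thesis by simp
qed

text \<open>The contracted vertex is matched along a cut edge \<open>ab\<close> with
  \<open>b\<close> in \<open>B\<close>. In \<open>G\<close> this edge is kept, and a matching of
  \<open>S - b\<close> takes care of the rest of \<open>S\<close>.\<close>

lemma matchable_if_None_unused:
  assumes pm: "matchable (shrink G S) (verts (shrink G S) - V)" and V: "None \<notin> V"
  shows "matchable G (verts G - (Some -` V - S))"
proof -
  let ?Y = "C - Some -` V"
  have eq: "verts G - (Some -` V - S) = ?Y \<union> S" using disjoint verts_eq by auto
  show ?thesis
  proof (cases "S = {}")
    case True
    then have "verts (shrink G S) = Some ` C" using verts_shrink by simp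
    then have "verts (shrink G S) - V = Some ` ?Y" by auto
    then have "matchable G ?Y" using matchable_lift[of ?Y] pm by simp
    then show ?thesis unfolding eq using True by simp
  next
    case False
    then have W: "verts (shrink G S) - V = insert None (Some ` ?Y)" using V by (auto simp: verts_shrink)
    from matchable_partner[OF loopless_shrink pm, of None] obtain e u where
      e: "e \<in> edges (shrink G S)" "ends (shrink G S) e = {None, u}" "u \<noteq> None"
      "u \<in> insert None (Some ` ?Y)" "matchable (shrink G S) (insert None (Some ` ?Y) - {None, u})"
      unfolding W by blast
    then obtain a where a: "u = Some a" "a \<in> ?Y" by auto
    obtain b where b: "e \<in> edges G" "ends G e = {a, b}" "b \<in> B" "matchable G (S - {b})"
      using end_None_Some[OF e(1)] e(2) a by metis
    have "insert None (Some ` ?Y) - {None, u} = Some ` (?Y - {a})" using a by auto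
    then have "matchable G (?Y - {a})" using matchable_lift[of "?Y - {a}"] e(5) by auto
    then have "matchable G ((?Y - {a}) \<union> {a, b} \<union> (S - {b}))"
      using matchable_edge[OF b(1,2)] b(3,4) a(2) B_sub disjoint by (intro matchable_Un) auto
    moreover have "(?Y - {a}) \<union> {a, b} \<union> (S - {b}) = ?Y \<union> S" using a b B_sub by auto
    ultimately show ?thesis unfolding eq by simp
  qed
qed

lemma model_verts_lift:
  assumes "path_model (shrink G S) J \<phi> pv pe"
  shows "Some -` model_verts J \<phi> pv - S = Some -` model_verts J \<phi> pv"
proof -
  have "model_verts J \<phi> pv \<subseteq> verts (shrink G S)"
    using assms is_path_verts unfolding path_model_def model_verts_def by fast
  then have "v \<in> C" if "Some v \<in> model_verts J \<phi> pv" for v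
    using that by (auto simp: verts_shrink split: if_splits)
  then show ?thesis using disjoint by auto
qed

lemma based_contraction_imp_based:
  fixes J :: "('w, 'f) multigraph"
  assumes J: "loopless_graph J" and deg: "\<And>w. w \<in> verts J \<Longrightarrow> degree J w \<le> 3"
    and based: "based J (shrink G S)"
  shows "based J G"
proof -
  obtain \<phi> pv pe where m: "path_model (shrink G S) J \<phi> pv pe"
    and pm: "matchable (shrink G S) (verts (shrink G S) - model_verts J \<phi> pv)"
    using based_imp_path_model[OF J based] by (elim exE conjE)
  let ?U = "\<phi> ` verts J"
  have inj: "inj_on \<phi> (verts J)" and U: "?U \<subseteq> verts (shrink G S)"
    using m by (auto simp: path_model_def)
  have p: "is_path (shrink G S) (pv e) (pe e)" "{hd (pv e), last (pv e)} = \<phi> ` ends J e"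
    "set (pv e) \<inter> ?U \<subseteq> \<phi> ` ends J e" "hd (pv e) \<noteq> last (pv e)" "ends J e \<subseteq> verts J"
    if "e \<in> edges J" for e
  proof -
    show *: "is_path (shrink G S) (pv e) (pe e)" "{hd (pv e), last (pv e)} = \<phi> ` ends J e"
      "set (pv e) \<inter> ?U \<subseteq> \<phi> ` ends J e" "ends J e \<subseteq> verts J"
      using m that J by (auto simp: path_model_def loopless_graph_def)
    show "hd (pv e) \<noteq> last (pv e)" by (rule inj_on_ends_neq[OF J inj that *(2)])
  qed
  have d: "set (pv e) \<inter> set (pv f) \<subseteq> ?U" if "e \<in> edges J" "f \<in> edges J" "e \<noteq> f" for e f
    using m that unfolding path_model_def by blast
  \<comment> \<open>The contracted vertex is a branch vertex, an internal vertex of the path of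
    \<open>e0\<close>, or avoided altogether. In the second case no other path contains it, because
    paths share only branch vertices.\<close>
  consider "None \<in> ?U" | e0 where "None \<notin> ?U" "e0 \<in> edges J" "None \<in> set (pv e0)"
    | "None \<notin> model_verts J \<phi> pv"
    unfolding model_verts_def by blast
  then show ?thesis
  proof cases
    case 1
    then obtain w0 where w0: "w0 \<in> verts J" "\<phi> w0 = None" by auto
    let ?E = "{e \<in> edges J. w0 \<in> ends J e}"
    have E: "finite ?E" "card ?E \<le> 3"
      using J deg[OF w0(1)] by (auto simp: loopless_graph_def degree_def)
    have None_notin: "None \<notin> set (pv e)" if "e \<in> edges J" "e \<notin> ?E" for e
    proof
      assume "None \<in> set (pv e)"
      then have "None \<in> \<phi> ` ends J e" using p(3)[OF that(1)] 1 by blast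
      then obtain w where "w \<in> ends J e" "\<phi> w = None" by auto
      then have "w = w0" using inj_onD[OF inj, of w w0] w0 p(5)[OF that(1)] by auto
      then show False using that \<open>w \<in> ends J e\<close> by simp
    qed
    define leg where "leg e b \<longleftrightarrow> b \<in> B \<and> matchable G (S - {b}) \<and>
      (\<forall>R RE. is_path G R RE \<and> last R = b \<and> set R \<subseteq> S \<and> odd (length R) \<longrightarrow>
        (\<exists>vs' es'. replaces (hd R) (set R) (pv e) (pe e) vs' es'))" for e b
    have "\<exists>b. leg e b" if "e \<in> ?E" for e
    proof -
      have e: "e \<in> edges J" "w0 \<in> ends J e" using that by auto
      then have "\<phi> w0 \<in> \<phi> ` ends J e" by simp
      then have "None \<in> {hd (pv e), last (pv e)}" unfolding p(2)[OF e(1)] w0(2) .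
      from replaces_end_None[OF p(1)[OF e(1)] this p(4)[OF e(1)]]
      show ?thesis unfolding leg_def .
    qed
    then obtain b where b: "\<And>e. e \<in> ?E \<Longrightarrow> leg e (b e)" by metis
    have "S \<noteq> {}" using 1 U by (auto simp: verts_shrink split: if_splits)
    then obtain b0 where b0: "b0 \<in> S" "matchable G (S - {b0})" using base by blast
    have SV: "S \<subseteq> verts G" using verts_eq by simp
    have bB: "\<forall>e\<in>?E. b e \<in> B \<and> matchable G (S - {b e})"
      using b unfolding leg_def by blast
    have sparse': "\<forall>T. T \<subseteq> B \<longrightarrow> matchable G (S - T) \<longrightarrow> card T \<le> 1"
      using sparse by blast
    obtain x R RE where x: "x \<in> S"
      and R: "\<forall>e\<in>?E. is_path G (R e) (RE e) \<and> hd (R e) = x \<and> last (R e) = b e \<and> set (R e) \<subseteq> S \<and>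
       odd (length (R e))"
      and Rd: "\<forall>e\<in>?E. \<forall>f\<in>?E. e \<noteq> f \<longrightarrow> set (R e) \<inter> set (R f) \<subseteq> {x}"
      and Rm: "matchable G (S - ({x} \<union> (\<Union>e\<in>?E. set (R e))))"
      using spider_exists[OF loopless finite_S SV B_sub sparse' bB E b0] by (elim bexE exE conjE)
    define Z where "Z e = (if e \<in> ?E then set (R e) else {})" for e
    have "\<exists>vs' es'. replaces x (Z e) (pv e) (pe e) vs' es'" if e: "e \<in> edges J" for e
    proof (cases "e \<in> ?E")
      case True
      have "\<exists>vs' es'. replaces (hd (R e)) (set (R e)) (pv e) (pe e) vs' es'"
        using b[OF True] bspec[OF R True] unfolding leg_def by blast
      then show ?thesis using bspec[OF R True] True by (simp add: Z_def)
    next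
      case False
      then have "Z e = {}" unfolding Z_def by (rule if_not_P)
      then show ?thesis using replaces_no_None[OF p(1)[OF e] None_notin[OF e False]] by simp
    qed
    then obtain pv' pe' where r: "\<forall>e\<in>edges J. replaces x (Z e) (pv e) (pe e) (pv' e) (pe' e)"
      by metis
    have ZS: "\<forall>e\<in>edges J. Z e \<subseteq> S" using R by (simp add: Z_def)
    have Zn: "\<forall>e\<in>edges J. None \<notin> set (pv e) \<longrightarrow> Z e = {}"
    proof (intro ballI impI)
      fix e assume that: "e \<in> edges J" "None \<notin> set (pv e)"
      have "e \<notin> ?E"
      proof
        assume "e \<in> ?E"
        then have "None \<in> {hd (pv e), last (pv e)}" using p(2)[OF that(1)] w0 by force
        moreover have "{hd (pv e), last (pv e)} \<subseteq> set (pv e)"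
          using is_path_not_Nil[OF p(1)[OF that(1)]] by simp
        ultimately show False using that(2) by blast
      qed
      then show "Z e = {}" unfolding Z_def by (rule if_not_P)
    qed
    have Zd: "\<forall>e\<in>edges J. \<forall>f\<in>edges J. e \<noteq> f \<longrightarrow> Z e \<inter> Z f \<subseteq> (if None \<in> ?U then {x} else {})"
      using Rd 1 by (simp add: Z_def)
    have xS: "(if None \<in> ?U then {x} else {}) \<subseteq> S" using x by simp
    note t = path_model_transfer[OF J m xS r ZS Zn Zd]
    have UZ: "(if None \<in> ?U then {x} else {}) \<union> (\<Union>e\<in>edges J. Z e) = {x} \<union> (\<Union>e\<in>?E. set (R e))"
      using 1 by (auto simp: Z_def)
    have "matchable G (verts G - (Some -` model_verts J \<phi> pv - S \<union> ({x} \<union> (\<Union>e\<in>?E. set (R e)))))"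
    proof (rule matchable_if_None_used[OF pm _ _ Rm])
      show "None \<in> model_verts J \<phi> pv" using 1 by (simp add: model_verts_def)
      show "{x} \<union> (\<Union>e\<in>?E. set (R e)) \<subseteq> S" using x R by blast
    qed
    then have "matchable G (verts G - model_verts J (case_option x id \<circ> \<phi>) pv')"
      using t(2) unfolding model_verts_lift[OF m] UZ by simp
    then show ?thesis using path_model_imp_based[OF loopless J t(1)] by simp
  next
    case (2 e0)
    \<comment> \<open>A dummy: \<open>None\<close> is not the image of a vertex of \<open>J\<close>,
      so its new name never occurs.\<close>
    fix x :: 'v
    have h: "hd (pv e0) \<noteq> None" "last (pv e0) \<noteq> None"
    proof -
      have "{hd (pv e0), last (pv e0)} \<subseteq> ?U" using p(2,5)[OF 2(2)] by auto
      then show "hd (pv e0) \<noteq> None" "last (pv e0) \<noteq> None" using 2(1) by (metis insert_subset)+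
    qed
    obtain b1 b2 where b: "b1 \<in> B" "b2 \<in> B" "matchable G (S - {b1})" "matchable G (S - {b2})"
      "\<forall>R RE. is_path G R RE \<and> hd R = b1 \<and> last R = b2 \<and> set R \<subseteq> S \<and> odd (length R) \<longrightarrow>
      (\<exists>vs' es'. replaces x (set R) (pv e0) (pe e0) vs' es')"
      using replaces_internal_None[OF p(1)[OF 2(2)] 2(3) h, of x] by (elim exE conjE)
    have bS: "b1 \<in> S" "b2 \<in> S" "S \<subseteq> verts G" using b B_sub verts_eq by auto
    \<comment> \<open>An ear towards the set \<open>{b2}\<close> is an odd path from
      \<open>b1\<close> to \<open>b2\<close>; for \<open>b1 = b2\<close> it is a single
      vertex.\<close>
    obtain R RE where R: "is_path G R RE" "hd R = b1" "set R \<subseteq> S" "odd (length R)"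
      "set R \<inter> {b2} = {last R}" "matchable G (S - {b2} - set R)"
      using alternating_ear[OF loopless finite_S bS(3) _ bS(1) b(4) b(3)] bS by auto
    have "last R \<in> set R \<inter> {b2}" unfolding R(5) by simp
    then have l: "last R = b2" "b2 \<in> set R" by auto
    have Rm: "matchable G (S - set R)"
    proof -
      have "S - set R = S - {b2} - set R" using l by auto
      then show ?thesis using R(6) by simp
    qed
    define Z where "Z e = (if e = e0 then set R else {})" for e
    have None_notin: "None \<notin> set (pv e)" if "e \<in> edges J" "e \<noteq> e0" for e
      using d[OF that(1) 2(2) that(2)] 2(1,3) by blast
    have "\<exists>vs' es'. replaces x (Z e) (pv e) (pe e) vs' es'" if e: "e \<in> edges J" for e
    proof (cases "e = e0")
      case True
      then show ?thesis using b(5) R l by (auto simp: Z_def)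
    next
      case False
      then show ?thesis using replaces_no_None[OF p(1)[OF e] None_notin[OF e False]] by (simp add: Z_def)
    qed
    then obtain pv' pe' where r: "\<forall>e\<in>edges J. replaces x (Z e) (pv e) (pe e) (pv' e) (pe' e)"
      by metis
    have ZS: "\<forall>e\<in>edges J. Z e \<subseteq> S" using R(3) by (simp add: Z_def)
    have Zn: "\<forall>e\<in>edges J. None \<notin> set (pv e) \<longrightarrow> Z e = {}"
      using 2(3) by (auto simp: Z_def)
    have Zd: "\<forall>e\<in>edges J. \<forall>f\<in>edges J. e \<noteq> f \<longrightarrow> Z e \<inter> Z f \<subseteq> (if None \<in> ?U then {x} else {})"
      by (simp add: Z_def)
    have xS: "(if None \<in> ?U then {x} else {}) \<subseteq> S" using 2(1) by simp
    note t = path_model_transfer[OF J m xS r ZS Zn Zd]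
    have UZ: "(if None \<in> ?U then {x} else {}) \<union> (\<Union>e\<in>edges J. Z e) = set R"
      using 2(1,2) by (auto simp: Z_def)
    have "None \<in> model_verts J \<phi> pv" using 2 by (auto simp: model_verts_def)
    from matchable_if_None_used[OF pm this R(3) Rm]
    have "matchable G (verts G - model_verts J (case_option x id \<circ> \<phi>) pv')"
      using t(2) unfolding model_verts_lift[OF m] UZ by simp
    then show ?thesis using path_model_imp_based[OF loopless J t(1)] by simp
  next
    case 3
    fix x :: 'v
    have "None \<notin> set (pv e)" if "e \<in> edges J" for e
      using 3 that by (auto simp: model_verts_def)
    then have "\<exists>vs' es'. replaces x {} (pv e) (pe e) vs' es'" if "e \<in> edges J" for e
      using replaces_no_None[OF p(1)] that by blast
    then obtain pv' pe' where r: "\<forall>e\<in>edges J. replaces x {} (pv e) (pe e) (pv' e) (pe' e)"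
      by metis
    have nU: "None \<notin> ?U" using 3 by (simp add: model_verts_def)
    then have xS: "(if None \<in> ?U then {x} else {}) \<subseteq> S" by simp
    have Z: "\<forall>e\<in>edges J. {} \<subseteq> S" "\<forall>e\<in>edges J. None \<notin> set (pv e) \<longrightarrow> {} = {}"
      "\<forall>e\<in>edges J. \<forall>f\<in>edges J. e \<noteq> f \<longrightarrow> {} \<inter> {} \<subseteq> (if None \<in> ?U then {x} else {})"
      by simp_all
    note t = path_model_transfer[where Z = "\<lambda>_. {}", OF J m xS r Z]
    have "matchable G (verts G - model_verts J (case_option x id \<circ> \<phi>) pv')"
      using t(2) matchable_if_None_unused[OF pm 3] nU unfolding model_verts_lift[OF m] by simp
    then show ?thesis using path_model_imp_based[OF loopless J t(1)] by simp
  qed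
qed

end

section \<open>Application to a component of the graph minus the barrier\<close>

lemma connected_edge_out:
  assumes "connected_graph G" "loopless_graph G" "u \<in> C" "u \<in> verts G" "v \<in> verts G" "v \<notin> C"
  obtains e a b where "e \<in> edges G" "ends G e = {a, b}" "a \<in> C" "b \<notin> C"
proof -
  have "(u, v) \<in> (adj G)\<^sup>*" using assms by (auto simp: connected_graph_def reach_def)
  then have "v \<notin> C \<longrightarrow> (\<exists>a b. (a, b) \<in> adj G \<and> a \<in> C \<and> b \<notin> C)"
    by (induction rule: rtrancl_induct) (use assms(3) in blast)+
  then show thesis using that assms(6) by (auto simp: adj_def)
qed

theorem theorem40:
  fixes G :: "('v, 'e) multigraph" and J :: "('w, 'f) multigraph" and B :: "'v set"
  assumes "matching_covered G"
    and "barrier G B"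
    and "matching_covered J"
    and "max_degree J \<le> 3"
    and "\<exists>L \<in> components (delete_verts G B). based J (shrink G (verts G - verts L))"
  shows "based J G"
proof -
  have G: "loopless_graph G" "connected_graph G"
    and cov: "\<And>e. e \<in> edges G \<Longrightarrow> \<exists>M. perfect_matching G M \<and> e \<in> M"
    using assms(1) by (auto simp: matching_covered_def)
  have J: "loopless_graph J" using assms(3) by (simp add: matching_covered_def)
  have deg: "degree J w \<le> 3" if "w \<in> verts J" for w
  proof -
    have "degree J w \<le> max_degree J"
      unfolding max_degree_def using that J by (intro Max_ge) (auto simp: loopless_graph_def)
    then show ?thesis using assms(4) by simp
  qed
  have B: "B \<subseteq> verts G" "card (odd_classes G B) = card B"
    using assms(2) by (auto simp: barrier_def card_odd_components)
  obtain C where C: "C \<in> verts (delete_verts G B) // reach (delete_verts G B)"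
    and based: "based J (shrink G (verts G - C))"
    using assms(5) verts_induced_class[of _ G B] by (auto simp: components_def)
  have CV: "C \<subseteq> verts G - B" by (rule class_subset[OF C])
  have "C \<noteq> {}" using in_quotient_imp_non_empty[OF equiv_reach C] .
  \<comment> \<open>Here every edge of \<open>G\<close> has to lie in a perfect matching: the count
    concerns matching edges that leave \<open>C\<close>, and the conclusion is wanted for all edges
    that leave \<open>C\<close>.\<close>
  have cut: "b \<in> B \<and> odd (card C) \<and> matchable G (verts G - C - {b})"
    if e: "e \<in> edges G" "ends G e = {a, b}" "a \<in> C" "b \<notin> C" for e a b
  proof -
    obtain M where "perfect_matching G M" "e \<in> M" using cov e by blast
    then show ?thesis
      using matching_meets_class_once[OF G(1) B C _ _ e(2-4)] perfect_matching_covers[OF G(1)] by blast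
  qed
  have out: "\<exists>e a b. e \<in> edges G \<and> ends G e = {a, b} \<and> a \<in> C \<and> b \<notin> C \<and> b \<in> verts G"
    if ne: "verts G - C \<noteq> {}"
  proof -
    obtain u v where uv: "u \<in> C" "v \<in> verts G" "v \<notin> C" using ne \<open>C \<noteq> {}\<close> by blast
    then have "u \<in> verts G" using CV by blast
    from connected_edge_out[OF G(2,1) uv(1) this uv(2,3)]
    obtain e a b where e: "e \<in> edges G" "ends G e = {a, b}" "a \<in> C" "b \<notin> C" .
    then have "b \<in> verts G" using G(1) by (auto simp: loopless_graph_def)
    then show ?thesis using e by blast
  qed
  interpret contracted_side G C "verts G - C" B
  proof
    show "B \<subseteq> verts G - C" using B CV by blast
    show "card T \<le> 1" if T: "T \<subseteq> B" "matchable G (verts G - C - T)" for T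
    \<comment> \<open>The parity of \<open>C\<close> is known only through an edge leaving it. If
      there is none, connectedness gives \<open>S = {}\<close>, and then \<open>B\<close> is empty
      as a subset of \<open>S\<close>.\<close>
    proof (cases "verts G - C = {}")
      case True
      then have "T = {}" using T(1) B CV by blast
      then show ?thesis by simp
    next
      case False
      then have "C \<in> odd_classes G B" using out cut C by (auto simp: odd_classes_def)
      then show ?thesis using removable_barrier_part[OF G(1) B _ T] by blast
    qed
    show "\<exists>b\<in>verts G - C. matchable G (verts G - C - {b})" if "verts G - C \<noteq> {}"
      using out[OF that] cut by blast
  qed (use G CV cut in auto)
  show ?thesis by (rule based_contraction_imp_based[OF J deg based])
qed

end
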